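(* Let $r\ge 3$. There are a constant $C_r>0$ (depending only on $r$) and a function $\varepsilon(n)=\varepsilon_r(n)\to 0$ as $n\to\infty$ such that for every $n\ge1$ and every $r$-coloring of the edges of $K_n$, with $G_i$ denoting the graph of $i$-colored edges for $i\in[r]$, $$n^{\left(\frac12+\varepsilon(n)\right)\log_r n}\le\prod_{i=1}^r k(G_i)\le C_r\, n^{\binom r2}\,2^n .$$ Furthermore, the upper bound is tight up to the constant: there is $c_r>0$ depending only on $r$ such that for every $n\ge 1$ some $r$-coloring of the edges of $K_n$ satisfies $\prod_{i=1}^r k(G_i)\ge c_r\,n^{\binom r2}2^n$. And the lower bound is tight up to a multiple of $3\log_3 r$ in the exponent: there is a function $\delta(n)=\delta_r(n)\to0$ such that for every $n\ge 1$ some $r$-coloring of the edges of $K_n$ satisfies $\prod_{i=1}^r k(G_i)\le n^{(3\log_3 r)\left(\frac12+\delta(n)\right)\log_r n}$ for all sufficiently large $n$.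
   Context: $[r]=\{1,\dots,r\}$. An $r$-coloring assigns each edge of $K_n$ exactly one color in $[r]$ (colors may be unused); each $G_i$ has the full vertex set of $K_n$. $k(G)$ is the number of cliques of $G$, i.e. vertex subsets inducing a complete subgraph; the empty set and all singletons count as cliques. *)

theory Defs
  imports Complex_Main "HOL-Library.Ramsey"
begin

text \<open>A graph is given by a vertex set and a set of two-element edges.  The complete graph
  \<open>K\<^sub>n\<close> has vertex set \<open>{..<n}\<close> and edge set \<open>[{..<n}]\<^bsup>2\<^esup>\<close>.  A coloring is a total function on
  sets of vertices; its values outside \<open>[{..<n}]\<^bsup>2\<^esup>\<close> are irrelevant.\<close>

definition edge_colorings :: "nat \<Rightarrow> nat \<Rightarrow> (nat set \<Rightarrow> nat) set" where
  "edge_colorings r n = [{..<n}]\<^bsup>2\<^esup> \<rightarrow> {1..r}"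

definition color_class :: "nat \<Rightarrow> (nat set \<Rightarrow> nat) \<Rightarrow> nat \<Rightarrow> nat set set" where
  "color_class n c i = {e \<in> [{..<n}]\<^bsup>2\<^esup>. c e = i}"

definition num_cliques :: "'a set \<Rightarrow> 'a set set \<Rightarrow> nat" where
  "num_cliques V E = card {S. S \<subseteq> V \<and> clique S E}"

text \<open>The product of \<open>k(G\<^sub>i)\<close> over all colors \<open>i\<close>; every \<open>G\<^sub>i\<close> has the full vertex set of \<open>K\<^sub>n\<close>,
  so an unused color contributes the factor \<open>n + 1\<close>.\<close>

definition clique_product :: "nat \<Rightarrow> nat \<Rightarrow> (nat set \<Rightarrow> nat) \<Rightarrow> nat" where
  "clique_product r n c = (\<Prod>i = 1..r. num_cliques {..<n} (color_class n c i))"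

end

theory Submission
  imports Defs "HOL-Real_Asymp.Real_Asymp"
begin

text \<open>Lower bound: some color \<open>i\<close> is the majority color at a fraction \<open>1 / r\<close> of the vertices.
  Counting the cliques of \<open>G\<^sub>i\<close> by their vertices, the product for \<open>n\<close> vertices is at least
  \<open>n / (r L)\<close> times the product for \<open>n / r\<close> vertices, where \<open>L\<close> bounds the clique sizes;
  this is iterated \<open>log\<^sub>r n\<close> times.

  Upper bound: let \<open>M\<^sub>i\<close> be a maximum clique of \<open>G\<^sub>i\<close> and \<open>W\<close> the set of vertices in none of them.
  A clique \<open>S\<close> of \<open>G\<^sub>i\<close> has at most one vertex in each other \<open>M\<^sub>j\<close>, and each vertex outside \<open>M\<^sub>i\<close>
  excludes its non-neighbours in \<open>M\<^sub>i\<close>. For a pair \<open>i, j\<close> every edge between \<open>M\<^sub>i\<close> and \<open>M\<^sub>j\<close> is a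
  non-edge of \<open>G\<^sub>i\<close> or of \<open>G\<^sub>j\<close>, so the choices of the two crossing vertices contribute only \<open>O(n)\<close>.
  Since \<open>M\<^sub>i\<close> is maximum, \<open>S \<inter> W\<close> costs a factor exponential in its size, and the tuples of cliques
  in \<open>W\<close> contribute \<open>O(2\<^bsup>|W|\<^esup>)\<close>.

  The upper bound is attained by an explicit coloring in which level \<open>i\<close> is joined in color \<open>i\<close>
  to a complete multipartite graph of the same color on the higher levels; the lower
  bound is nearly attained by a random coloring that uses only three colors.\<close>

section \<open>Basic facts on counting cliques\<close>

lemma real_choose_two: "real (k choose 2) = real k * (real k - 1) / 2"
  by (induction k) (auto simp: numeral_2_eq_2 field_simps)

definition cliques :: "'a set \<Rightarrow> 'a set set \<Rightarrow> 'a set set" where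
  "cliques V E = {S. S \<subseteq> V \<and> clique S E}"

lemma num_cliques_eq: "num_cliques V E = card (cliques V E)"
  by (simp add: num_cliques_def cliques_def)

lemma finite_cliques [simp]: "finite V \<Longrightarrow> finite (cliques V E)"
  by (rule finite_subset[of _ "Pow V"]) (auto simp: cliques_def)

lemma empty_in_cliques [simp]: "{} \<in> cliques V E"
  by (simp add: cliques_def clique_def)

lemma cliques_mono: "U \<subseteq> V \<Longrightarrow> cliques U E \<subseteq> cliques V E"
  by (auto simp: cliques_def)

lemma num_cliques_mono: "finite V \<Longrightarrow> U \<subseteq> V \<Longrightarrow> num_cliques U E \<le> num_cliques V E"
  unfolding num_cliques_eq by (intro card_mono finite_cliques cliques_mono)

lemma num_cliques_pos: "finite V \<Longrightarrow> num_cliques V E \<ge> 1"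
  unfolding num_cliques_eq by (metis One_nat_def Suc_leI card_gt_0_iff empty_in_cliques empty_iff finite_cliques)

text \<open>All subsets of a clique are cliques. In the lower bound this settles the case of one
  very large clique.\<close>

lemma num_cliques_ge_power:
  assumes "finite V" "S \<in> cliques V E"
  shows "2 ^ card S \<le> num_cliques V E"
proof -
  have "Pow S \<subseteq> cliques V E"
    using assms(2) smaller_clique by (fastforce simp: cliques_def)
  moreover have "finite S"
    using assms finite_subset by (auto simp: cliques_def)
  ultimately show ?thesis
    unfolding num_cliques_eq using card_mono[OF finite_cliques[OF assms(1)], of "Pow S" E]
    by (simp add: card_Pow)
qed

section \<open>Lower bound\<close>

definition neighbours :: "'a set \<Rightarrow> 'a set set \<Rightarrow> 'a \<Rightarrow> 'a set" where
  "neighbours V E v = {w \<in> V. w \<noteq> v \<and> {v, w} \<in> E}"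

lemma neighbours_subset: "neighbours V E v \<subseteq> V"
  by (auto simp: neighbours_def)

text \<open>Double counting of cliques with a marked vertex: a clique \<open>S\<close> among the
  neighbours of \<open>v\<close> becomes \<open>insert v S\<close> with \<open>v\<close> marked, and
  a clique offers at most \<open>L\<close> choices of the mark.\<close>

lemma sum_num_cliques_neighbours:
  assumes "finite V" "A \<subseteq> V" and L: "\<And>S. S \<in> cliques V E \<Longrightarrow> real (card S) \<le> L"
  shows "(\<Sum>v\<in>A. real (num_cliques (neighbours V E v) E)) \<le> L * real (num_cliques V E)"
proof -
  let ?N = "neighbours V E"
  have fin: "finite A" "\<And>v. finite (?N v)"
    using assms neighbours_subset finite_subset by metis+
  have finS: "finite S" if "S \<in> cliques V E" for S
    using that assms(1) finite_subset by (auto simp: cliques_def)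
  have "(\<Sum>v\<in>A. num_cliques (?N v) E) = card (Sigma A (\<lambda>v. cliques (?N v) E))"
    using fin by (simp add: num_cliques_eq)
  also have "\<dots> \<le> card (Sigma (cliques V E) (\<lambda>S. S))"
  proof (rule card_inj_on_le[where f = "\<lambda>(v, S). (insert v S, v)"])
    show "inj_on (\<lambda>(v, S). (insert v S, v)) (Sigma A (\<lambda>v. cliques (?N v) E))"
    proof (rule inj_onI, clarsimp)
      fix v S T
      assume "S \<in> cliques (?N v) E" "T \<in> cliques (?N v) E" "insert v S = insert v T"
      moreover from this have "v \<notin> S" "v \<notin> T"
        by (auto simp: cliques_def neighbours_def)
      ultimately show "S = T"
        by (simp add: insert_ident)
    qed
    show "(\<lambda>(v, S). (insert v S, v)) ` (Sigma A (\<lambda>v. cliques (?N v) E)) \<subseteq> Sigma (cliques V E) (\<lambda>S. S)"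
    proof clarsimp
      fix v S assume *: "v \<in> A" "S \<in> cliques (?N v) E"
      have "{v, w} \<in> E" "{w, v} \<in> E" if "w \<in> S" for w
        using * that by (auto simp: cliques_def neighbours_def insert_commute)
      then show "insert v S \<in> cliques V E"
        using * assms(2) by (auto simp: cliques_def neighbours_def clique_def)
    qed
    show "finite (Sigma (cliques V E) (\<lambda>S. S))"
      using assms(1) finS by auto
  qed
  also have "\<dots> = (\<Sum>S\<in>cliques V E. card S)"
    using assms(1) finS by (simp add: card_SigmaI)
  finally have "(\<Sum>v\<in>A. real (num_cliques (?N v) E)) \<le> (\<Sum>S\<in>cliques V E. real (card S))"
    by (metis of_nat_le_iff of_nat_sum)
  also have "\<dots> \<le> (\<Sum>S\<in>cliques V E. L)"
    by (intro sum_mono L)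
  finally show ?thesis
    by (simp add: num_cliques_eq mult.commute)
qed

lemma prod_num_cliques_mono:
  assumes "finite V" "U \<subseteq> V"
  shows "(\<Prod>j\<in>J. real (num_cliques U (E j))) \<le> (\<Prod>j\<in>J. real (num_cliques V (E j)))"
  using num_cliques_mono[OF assms] by (intro prod_mono) auto

text \<open>Two pigeonhole steps yield \<open>card I ^ k\<close> vertices that share a color
  \<open>i\<close> in which each has at least \<open>card I ^ k\<close> neighbours. Summing the
  induction hypothesis for these neighbourhoods gains a factor \<open>card I ^ k / L\<close>, and
  the exponents 0, ..., k - 1 of the successive gains add up to \<open>k choose 2\<close>.\<close>

lemma prod_num_cliques_lower:
  fixes E :: "'i \<Rightarrow> 'a set set"
  assumes I: "finite I" "card I \<ge> 2"
    and "finite V" "card V \<ge> card I ^ k"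
    and "\<And>u v. u \<in> V \<Longrightarrow> v \<in> V \<Longrightarrow> u \<noteq> v \<Longrightarrow> \<exists>i\<in>I. {u, v} \<in> E i"
    and "\<And>i S. i \<in> I \<Longrightarrow> S \<in> cliques V (E i) \<Longrightarrow> real (card S) \<le> L"
    and "L > 0"
  shows "real (card I) ^ (k choose 2) / L ^ k \<le> (\<Prod>i\<in>I. real (num_cliques V (E i)))"
  using assms(3-6)
proof (induction k arbitrary: V)
  case 0
  have "(\<Prod>i\<in>I. (1::real)) \<le> (\<Prod>i\<in>I. real (num_cliques V (E i)))"
    using num_cliques_pos[OF 0(1)] by (intro prod_mono) auto
  then show ?case by (simp add: choose_two)
next
  case (Suc k)
  let ?r = "card I"
  let ?N = "\<lambda>i. neighbours V (E i)"
  have rk: "?r ^ k \<ge> 1" using I by simp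
  have finN: "finite (?N i v)" for i v
    using Suc.prems(1) neighbours_subset finite_subset by metis
  have "\<exists>i\<in>I. card (?N i v) \<ge> ?r ^ k" if v: "v \<in> V" for v
  proof (rule ccontr)
    assume "\<not> ?thesis"
    then have less: "card (?N i v) \<le> ?r ^ k - 1" if "i \<in> I" for i
      using that by fastforce
    have "V - {v} \<subseteq> (\<Union>i\<in>I. ?N i v)"
      using Suc.prems(3)[OF v] by (auto simp: neighbours_def)
    then have "card (V - {v}) \<le> card (\<Union>i\<in>I. ?N i v)"
      using I(1) finN by (intro card_mono) auto
    also have "\<dots> \<le> (\<Sum>i\<in>I. card (?N i v))"
      by (rule card_UN_le[OF I(1)])
    also have "\<dots> \<le> (\<Sum>i\<in>I. ?r ^ k - 1)"
      by (intro sum_mono less)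
    finally have "card V - 1 \<le> ?r * (?r ^ k - 1)"
      using v by simp
    \<comment> \<open>The summand 1 accounts for \<open>v\<close> itself; the two sides differ by
      \<open>card I - 1\<close>, which is positive.\<close>
    moreover have "?r * (?r ^ k - 1) + 1 < ?r ^ Suc k"
    proof -
      obtain m where "?r ^ k = Suc m"
        using rk by (metis Suc_le_D One_nat_def)
      then show ?thesis using I by simp
    qed
    ultimately show False
      using Suc.prems(2) by linarith
  qed
  then obtain g where g: "\<And>v. v \<in> V \<Longrightarrow> g v \<in> I" "\<And>v. v \<in> V \<Longrightarrow> card (?N (g v) v) \<ge> ?r ^ k"
    by metis
  have "\<exists>i\<in>I. card {v \<in> V. g v = i} \<ge> ?r ^ k"
  proof (rule ccontr)
    assume "\<not> ?thesis"
    then have less: "card {v \<in> V. g v = i} < ?r ^ k" if "i \<in> I" for i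
      using that by (meson leI)
    have "V = (\<Union>i\<in>I. {v \<in> V. g v = i})"
      using g(1) by auto
    then have "card V \<le> (\<Sum>i\<in>I. card {v \<in> V. g v = i})"
      using card_UN_le[OF I(1)] by metis
    also have "\<dots> < (\<Sum>i\<in>I. ?r ^ k)"
      using I less by (intro sum_strict_mono) auto
    finally show False
      using Suc.prems(2) by simp
  qed
  then obtain i where i: "i \<in> I" "card {v \<in> V. g v = i} \<ge> ?r ^ k"
    by blast
  define A where "A = {v \<in> V. g v = i}"
  let ?F = "\<lambda>U. \<Prod>j\<in>I. real (num_cliques U (E j))"
  let ?P = "\<Prod>j\<in>I - {i}. real (num_cliques V (E j))"
  have A: "A \<subseteq> V" by (auto simp: A_def)
  have split: "?F U = real (num_cliques U (E i)) * (\<Prod>j\<in>I - {i}. real (num_cliques U (E j)))" for U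
    using I(1) i(1) by (rule prod.remove)
  \<comment> \<open>Only the factor of color \<open>i\<close> stays on the neighbourhood, to be
    summed over \<open>v\<close>. The other factors are enlarged to \<open>V\<close> so that they
    can be taken out of the sum.\<close>
  have IH: "real ?r ^ (k choose 2) / L ^ k \<le> real (num_cliques (?N i v) (E i)) * ?P" if "v \<in> A" for v
  proof -
    have "real ?r ^ (k choose 2) / L ^ k \<le> ?F (?N i v)"
    proof (rule Suc.IH)
      show "?r ^ k \<le> card (?N i v)"
        using g(2)[of v] that by (auto simp: A_def)
      show "\<And>u w. u \<in> ?N i v \<Longrightarrow> w \<in> ?N i v \<Longrightarrow> u \<noteq> w \<Longrightarrow> \<exists>j\<in>I. {u, w} \<in> E j"
        using Suc.prems(3) neighbours_subset by fast
      show "\<And>j S. j \<in> I \<Longrightarrow> S \<in> cliques (?N i v) (E j) \<Longrightarrow> real (card S) \<le> L"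
        using Suc.prems(4) subsetD[OF cliques_mono[OF neighbours_subset]] by metis
    qed (rule finN)
    also have "\<dots> \<le> real (num_cliques (?N i v) (E i)) * ?P"
      unfolding split
      by (intro mult_left_mono prod_num_cliques_mono[OF Suc.prems(1) neighbours_subset]) simp
    finally show ?thesis .
  qed
  have "real (?r ^ k) * (real ?r ^ (k choose 2) / L ^ k) \<le> real (card A) * (real ?r ^ (k choose 2) / L ^ k)"
    using i(2) \<open>L > 0\<close> unfolding A_def by (intro mult_right_mono) (auto simp del: of_nat_power)
  also have "\<dots> = (\<Sum>v\<in>A. real ?r ^ (k choose 2) / L ^ k)"
    by simp
  also have "\<dots> \<le> (\<Sum>v\<in>A. real (num_cliques (?N i v) (E i)) * ?P)"
    by (intro sum_mono IH)
  also have "\<dots> = (\<Sum>v\<in>A. real (num_cliques (?N i v) (E i))) * ?P"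
    by (simp add: sum_distrib_right)
  also have "\<dots> \<le> (L * real (num_cliques V (E i))) * ?P"
    using Suc.prems(1) A Suc.prems(4)[OF i(1)]
    by (intro mult_right_mono sum_num_cliques_neighbours prod_nonneg) auto
  also have "\<dots> = L * ?F V"
    by (simp add: split mult.assoc)
  finally have *: "real (?r ^ k) * (real ?r ^ (k choose 2) / L ^ k) \<le> L * ?F V" .
  have "Suc k choose 2 = k + (k choose 2)"
    by (simp add: numeral_2_eq_2)
  then have "real ?r ^ (Suc k choose 2) / L ^ Suc k = real (?r ^ k) * (real ?r ^ (k choose 2) / L ^ k) / L"
    by (simp add: power_add)
  also have "\<dots> \<le> ?F V"
    using * \<open>L > 0\<close> by (simp add: pos_divide_le_eq mult_ac)
  finally show ?case .
qed

lemma prod_ge_factor: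
  fixes f :: "'i \<Rightarrow> real"
  assumes "finite I" "i \<in> I" "\<And>j. j \<in> I \<Longrightarrow> f j \<ge> 1"
  shows "f i \<le> prod f I"
proof -
  have "1 \<le> prod f (I - {i})"
    using assms by (intro prod_ge_1) auto
  then have "f i * 1 \<le> f i * prod f (I - {i})"
    using assms(3)[OF assms(2)] by (intro mult_left_mono) auto
  then show ?thesis
    using assms by (simp add: prod.remove)
qed

lemma color_class_cover:
  assumes "c \<in> edge_colorings r n" "u < n" "v < n" "u \<noteq> v"
  shows "\<exists>i\<in>{1..r}. {u, v} \<in> color_class n c i"
proof -
  have "{u, v} \<in> [{..<n}]\<^bsup>2\<^esup>"
    using assms by (simp add: nsets_def)
  then show ?thesis
    using assms(1) by (auto simp: edge_colorings_def color_class_def)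
qed

text \<open>With \<open>x = log\<^sub>r n\<close> and clique size threshold \<open>L = (log\<^sub>2 n)\<^sup>2 + 1\<close>, either a clique larger than \<open>L\<close>
  suffices on its own, or the recursion yields \<open>r powr ((x\<^sup>2 - 3 * x) / 2) / L powr x\<close>;
  the error term is what this leaves after division by \<open>x\<^sup>2\<close>.\<close>
definition lower_eps :: "nat \<Rightarrow> nat \<Rightarrow> real" where
  "lower_eps r n = - (3/2 * ln (real r) + ln ((log 2 (real n))\<^sup>2 + 1)) / ln (real n)"

lemma lower_eps_tendsto: "lower_eps r \<longlonglongrightarrow> 0"
proof -
  have "((\<lambda>n::nat. - (a + ln ((log 2 (real n))\<^sup>2 + 1)) / ln (real n)) \<longlonglongrightarrow> 0)" for a :: real
    by real_asymp
  then show ?thesis unfolding lower_eps_def by blast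
qed

lemma clique_product_lower:
  assumes r: "r \<ge> 2" and n: "n \<ge> 1" and c: "c \<in> edge_colorings r n"
  shows "real n powr ((1/2 + lower_eps r n) * log (real r) (real n)) \<le> real (clique_product r n c)"
\<comment> \<open>Here \<open>lower_eps\<close> divides by \<open>ln 1 = 0\<close>, but any power of
  1 is 1.\<close>
proof (cases "n = 1")
  case True
  have "(1::real) \<le> (\<Prod>i = 1..r. real (num_cliques {..<n} (color_class n c i)))"
    using num_cliques_pos[of "{..<n}"] by (intro prod_ge_1) auto
  then show ?thesis using True by (simp add: clique_product_def)
next
  case False
  with n have n2: "n \<ge> 2" by simp
  define x where "x = log (real r) (real n)"
  define l where "l = log 2 (real n)"
  define L where "L = l\<^sup>2 + 1"
  let ?k = "\<lambda>i. real (num_cliques {..<n} (color_class n c i))"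
  have L1: "L \<ge> 1" by (simp add: L_def)
  have r1: "real r > 1" using r by simp
  have lnr: "ln (real r) > 0" "ln (real n) > 0" "ln 2 \<le> ln (real r)"
    using r n2 by simp_all
  have x0: "x > 0" using r1 n2 by (simp add: x_def)
  have nx: "real n = real r powr x" using r1 n2 by (simp add: x_def)
  have xl: "x \<le> l"
    unfolding x_def l_def log_def using lnr by (intro divide_left_mono) auto
  have eps: "lower_eps r n * x = - (3/2 + log (real r) L)"
    using lnr by (simp add: lower_eps_def x_def log_def L_def l_def field_simps)
  have prod_eq: "real (clique_product r n c) = (\<Prod>i\<in>{1..r}. ?k i)"
    by (simp add: clique_product_def)
  have log0: "log (real r) L \<ge> 0" using r1 L1 by simp
  show ?thesis
  \<comment> \<open>A clique with more than \<open>l\<^sup>2\<close> vertices already has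
    \<open>2 powr (l\<^sup>2)\<close> subsets, at least \<open>real n powr (x / 2)\<close> because
    \<open>x \<le> l\<close>. So \<open>L\<close> can be polylogarithmic, and
    \<open>L powr x\<close> only affects the error term.\<close>
  proof (cases "\<exists>i\<in>{1..r}. \<exists>S\<in>cliques {..<n} (color_class n c i). real (card S) > L")
    case True
    then obtain i S where i: "i \<in> {1..r}" "S \<in> cliques {..<n} (color_class n c i)" "real (card S) > L"
      by blast
    have "(1/2 + lower_eps r n) * x \<le> x / 2"
      using eps log0 by (simp add: algebra_simps)
    then have "real n powr ((1/2 + lower_eps r n) * x) \<le> real n powr (x / 2)"
      using n2 by (intro powr_mono) auto
    also have "\<dots> = 2 powr (l * (x / 2))"
      using n2 by (subst powr_powr[symmetric]) (simp add: l_def)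
    also have "\<dots> \<le> 2 powr (real (card S))"
    proof (rule powr_mono)
      have "l * (x / 2) \<le> l * l"
        using xl x0 by (intro mult_left_mono) auto
      then show "l * (x / 2) \<le> real (card S)"
        using i(3) by (simp add: L_def power2_eq_square)
    qed simp
    also have "\<dots> = real (2 ^ card S)"
      by (simp add: powr_realpow)
    also have "\<dots> \<le> ?k i"
      using num_cliques_ge_power[OF _ i(2)] by (simp del: of_nat_power)
    also have "\<dots> \<le> (\<Prod>i\<in>{1..r}. ?k i)"
      using num_cliques_pos[of "{..<n}"] i(1) by (intro prod_ge_factor) auto
    finally show ?thesis
      unfolding prod_eq x_def .
  next
    case False
    then have small: "real (card S) \<le> L" if "i \<in> {1..r}" "S \<in> cliques {..<n} (color_class n c i)" for i S
      using that by force
    \<comment> \<open>The largest \<open>k\<close> with \<open>r ^ k \<le> n\<close>, which is the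
      depth of the recursion.\<close>
    define k where "k = nat \<lfloor>x\<rfloor>"
    have k: "real k \<le> x" "x < real k + 1"
      using x0 by (auto simp: k_def)
    have "real (r ^ k) \<le> real n"
    proof -
      have "real (r ^ k) = real r powr real k"
        using r1 by (simp add: powr_realpow)
      also have "\<dots> \<le> real r powr x"
        using r1 k by (intro powr_mono) auto
      finally show ?thesis using nx by simp
    qed
    then have rk: "r ^ k \<le> n"
      by (simp del: of_nat_power)
    have "real n powr ((1/2 + lower_eps r n) * x) = real r powr (x * ((1/2 + lower_eps r n) * x))"
      by (simp add: nx powr_powr)
    also have "x * ((1/2 + lower_eps r n) * x) = x\<^sup>2 / 2 + (lower_eps r n * x) * x"
      by (simp add: algebra_simps power2_eq_square)
    also have "\<dots> = (x\<^sup>2 - 3 * x) / 2 - log (real r) L * x"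
      unfolding eps by (simp add: field_simps)
    also have "real r powr \<dots> = real r powr ((x\<^sup>2 - 3 * x) / 2) / L powr x"
      using r1 L1 by (simp add: powr_diff powr_powr[symmetric])
    also have "\<dots> \<le> real r powr (real (k choose 2)) / L powr (real k)"
    proof (intro frac_le powr_mono)
      have "2 * real (k choose 2) = real k * (real k - 1)"
        by (simp add: real_choose_two)
      \<comment> \<open>The sum equals \<open>k * (k - 1) - (x\<^sup>2 - 3 * x)\<close>, and each of
        its terms is nonnegative because \<open>x - k\<close> lies between 0 and 1.\<close>
      moreover have "0 \<le> (x - real k) * (x - real k) + (1 - (x - real k)) * (2 * x) + (x - real k)"
        using k x0 by (intro add_nonneg_nonneg mult_nonneg_nonneg) auto
      ultimately show "(x\<^sup>2 - 3 * x) / 2 \<le> real (k choose 2)"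
        by (simp add: algebra_simps power2_eq_square)
    qed (use r1 L1 k in auto)
    also have "\<dots> = real (card {1..r}) ^ (k choose 2) / L ^ k"
      using r1 L1 by (simp add: powr_realpow)
    also have "\<dots> \<le> (\<Prod>i\<in>{1..r}. ?k i)"
    proof (rule prod_num_cliques_lower)
      show "\<exists>i\<in>{1..r}. {u, v} \<in> color_class n c i" if "u \<in> {..<n}" "v \<in> {..<n}" "u \<noteq> v" for u v
        using color_class_cover[OF c] that by simp
    qed (use r rk small L1 in auto)
    finally show ?thesis
      unfolding prod_eq x_def .
  qed
qed

section \<open>Upper bound\<close>

text \<open>What choosing \<open>X\<close> forbids inside \<open>M\<close> to a clique containing
  \<open>X\<close>. Vertices of \<open>X\<close> are exempt because two maximum cliques can overlap
  in a vertex.\<close>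

definition nonadj :: "'a set \<Rightarrow> 'a set set \<Rightarrow> 'a set \<Rightarrow> 'a set" where
  "nonadj M E X = {y \<in> M - X. \<exists>x\<in>X. {x, y} \<notin> E}"

lemma nonadj_subset: "nonadj M E X \<subseteq> M"
  by (auto simp: nonadj_def)

lemma nonadj_empty [simp]: "nonadj M E {} = {}"
  by (simp add: nonadj_def)

lemma finite_clique_sets: "finite V \<Longrightarrow> S \<in> cliques V E \<Longrightarrow> finite S"
  by (auto simp: cliques_def intro: finite_subset)

text \<open>A clique is recorded by its traces on the pieces \<open>R j\<close> and on \<open>M\<close>; the trace on \<open>M\<close> avoids
  all the sets \<open>nonadj\<close> of the other traces, whose union is at least as large as their average.
  Taking averages with \<open>q ^ r = 1/2\<close> makes the bound a product over \<open>j\<close>.\<close>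
lemma num_cliques_split:
  fixes q :: real
  assumes "finite V" "finite M" "finite J" "card J = r"
    and cover: "V \<subseteq> M \<union> (\<Union>j\<in>J. R j)"
    and finR: "\<And>j. j \<in> J \<Longrightarrow> finite (R j)"
    and q: "0 < q" "q \<le> 1" "q ^ r = 1/2"
  shows "real (num_cliques V E) \<le> 2 ^ card M * (\<Prod>j\<in>J. \<Sum>X\<in>cliques (R j) E. q ^ card (nonadj M E X))"
proof -
  let ?D = "nonadj M E"
  let ?P = "PiE J (\<lambda>j. cliques (R j) E)"
  let ?B = "\<lambda>X. Pow (M - (\<Union>j\<in>J. ?D (X j)))"
  have finP: "finite ?P"
    using assms by (intro finite_PiE) auto
  have "num_cliques V E \<le> card (Sigma ?P ?B)"
    unfolding num_cliques_eq
  proof (rule card_inj_on_le[where f = "\<lambda>S. (\<lambda>j\<in>J. S \<inter> R j, S \<inter> M)"])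
    show "inj_on (\<lambda>S. (\<lambda>j\<in>J. S \<inter> R j, S \<inter> M)) (cliques V E)"
    proof (rule inj_onI)
      fix S T assume *: "S \<in> cliques V E" "T \<in> cliques V E"
        and eq: "(\<lambda>j\<in>J. S \<inter> R j, S \<inter> M) = (\<lambda>j\<in>J. T \<inter> R j, T \<inter> M)"
      have 1: "S \<inter> M = T \<inter> M" using eq by simp
      have 2: "S \<inter> R j = T \<inter> R j" if "j \<in> J" for j
        using eq that by (metis Pair_inject restrict_apply')
      have "S = (S \<inter> M) \<union> (\<Union>j\<in>J. S \<inter> R j)" "T = (T \<inter> M) \<union> (\<Union>j\<in>J. T \<inter> R j)"
        using * cover by (auto simp: cliques_def)
      with 1 2 show "S = T" by auto
    qed
    show "(\<lambda>S. (\<lambda>j\<in>J. S \<inter> R j, S \<inter> M)) ` cliques V E \<subseteq> Sigma ?P ?B"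
    proof (rule image_subsetI)
      fix S assume S: "S \<in> cliques V E"
      have "y \<notin> ?D (S \<inter> R j)" if "y \<in> S" for y j
      proof
        assume "y \<in> ?D (S \<inter> R j)"
        then obtain x where "x \<in> S" "{x, y} \<notin> E" "x \<noteq> y"
          using that by (auto simp: nonadj_def)
        with S that show False by (auto simp: cliques_def clique_def)
      qed
      then show "(\<lambda>j\<in>J. S \<inter> R j, S \<inter> M) \<in> Sigma ?P ?B"
        using S by (auto simp: cliques_def clique_def)
    qed
    show "finite (Sigma ?P ?B)"
      using finP \<open>finite M\<close> by (intro finite_SigmaI) auto
  qed
  also have "\<dots> = (\<Sum>X\<in>?P. 2 ^ card (M - (\<Union>j\<in>J. ?D (X j))))"
    using finP \<open>finite M\<close> by (simp add: card_SigmaI card_Pow)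
  finally have "real (num_cliques V E) \<le> real (\<Sum>X\<in>?P. 2 ^ card (M - (\<Union>j\<in>J. ?D (X j))))"
    by (simp only: of_nat_le_iff)
  also have "\<dots> = (\<Sum>X\<in>?P. 2 ^ card (M - (\<Union>j\<in>J. ?D (X j))))"
    by simp
  also have "\<dots> \<le> (\<Sum>X\<in>?P. 2 ^ card M * (\<Prod>j\<in>J. q ^ card (?D (X j))))"
  proof (rule sum_mono)
    fix X
    let ?U = "\<Union>j\<in>J. ?D (X j)"
    have UM: "?U \<subseteq> M" by (auto simp: nonadj_def)
    then have finU: "finite ?U" using \<open>finite M\<close> finite_subset by blast
    have "card (?D (X j)) \<le> card ?U" if "j \<in> J" for j
      using finU that by (intro card_mono) auto
    then have "(\<Sum>j\<in>J. card (?D (X j))) \<le> (\<Sum>j\<in>J. card ?U)"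
      by (rule sum_mono)
    then have "(\<Sum>j\<in>J. card (?D (X j))) \<le> r * card ?U"
      using assms(4) by simp
    then have "q ^ (r * card ?U) \<le> q ^ (\<Sum>j\<in>J. card (?D (X j)))"
      using q by (intro power_decreasing) auto
    then have "(1/2) ^ card ?U \<le> (\<Prod>j\<in>J. q ^ card (?D (X j)))"
      using q(3) by (simp add: power_mult power_sum)
    then have "2 ^ card M * (1/2) ^ card ?U \<le> (2::real) ^ card M * (\<Prod>j\<in>J. q ^ card (?D (X j)))"
      by (intro mult_left_mono) auto
    moreover have "(2::real) ^ card (M - ?U) = 2 ^ card M * (1/2) ^ card ?U"
      unfolding card_Diff_subset[OF finU UM] power_one_over
      by (subst power_diff[OF _ card_mono[OF \<open>finite M\<close> UM]]) simp_all
    ultimately show "(2::real) ^ card (M - ?U) \<le> 2 ^ card M * (\<Prod>j\<in>J. q ^ card (?D (X j)))"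
      by simp
  qed
  also have "\<dots> = 2 ^ card M * (\<Prod>j\<in>J. \<Sum>X\<in>cliques (R j) E. q ^ card (?D X))"
    using finR \<open>finite J\<close> by (simp add: prod_sum_PiE sum_distrib_left)
  finally show ?thesis .
qed

text \<open>The row of \<open>x\<close> contains \<open>card (D x)\<close> pairs with \<open>y \<in> D x\<close>, each of weight at most
  \<open>q ^ card (D x)\<close>, so it contributes at most \<open>K\<close>; likewise for columns. Hence the sum over
  all pairs is linear in \<open>n\<close> and not quadratic.\<close>
lemma half_graph_sum:
  fixes q K :: real
  assumes fin: "finite P" "finite Q"
    and D: "\<And>x. x \<in> P \<Longrightarrow> D x \<subseteq> Q" "\<And>y. y \<in> Q \<Longrightarrow> D' y \<subseteq> P"
    and cover: "\<And>x y. x \<in> P \<Longrightarrow> y \<in> Q \<Longrightarrow> x \<noteq> y \<Longrightarrow> y \<in> D x \<or> x \<in> D' y"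
    and card: "card P \<le> n" "card Q \<le> n" "1 \<le> n"
    and q: "0 \<le> q" "q \<le> 1" and K: "\<And>t. real t * q ^ t \<le> K"
  shows "(1 + (\<Sum>x\<in>P. q ^ card (D x))) * (1 + (\<Sum>y\<in>Q. q ^ card (D' y))) \<le> (2 * K + 4) * real n"
proof -
  let ?a = "\<lambda>x. q ^ card (D x)" and ?b = "\<lambda>y. q ^ card (D' y)"
  have ab: "0 \<le> ?a x" "?a x \<le> 1" "0 \<le> ?b x" "?b x \<le> 1" for x
    using q by (auto simp: power_le_one)
  have K0: "K \<ge> 0" using K[of 0] by simp
  have A: "(\<Sum>x\<in>P. \<Sum>y\<in>Q. if y \<in> D x then ?a x else 0) \<le> K * real n"
  proof -
    have "(\<Sum>y\<in>Q. if y \<in> D x then ?a x else 0) \<le> K" if "x \<in> P" for x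
    proof -
      have "(\<Sum>y\<in>Q. if y \<in> D x then ?a x else 0) = (\<Sum>y\<in>D x. ?a x)"
        using fin D(1)[OF that] by (intro sum.mono_neutral_cong_right) auto
      then show ?thesis using K[of "card (D x)"] by simp
    qed
    then have "(\<Sum>x\<in>P. \<Sum>y\<in>Q. if y \<in> D x then ?a x else 0) \<le> real (card P) * K"
      by (rule sum_bounded_above)
    also have "\<dots> \<le> K * real n"
      using card K0 by (simp add: mult.commute mult_left_mono)
    finally show ?thesis .
  qed
  have B: "(\<Sum>x\<in>P. \<Sum>y\<in>Q. if x \<in> D' y then ?b y else 0) \<le> K * real n"
  proof -
    have "(\<Sum>x\<in>P. if x \<in> D' y then ?b y else 0) \<le> K" if "y \<in> Q" for y
    proof -
      have "(\<Sum>x\<in>P. if x \<in> D' y then ?b y else 0) = (\<Sum>x\<in>D' y. ?b y)"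
        using fin D(2)[OF that] by (intro sum.mono_neutral_cong_right) auto
      then show ?thesis using K[of "card (D' y)"] by simp
    qed
    then have "(\<Sum>y\<in>Q. \<Sum>x\<in>P. if x \<in> D' y then ?b y else 0) \<le> real (card Q) * K"
      by (rule sum_bounded_above)
    also have "\<dots> \<le> K * real n"
      using card K0 by (simp add: mult.commute mult_left_mono)
    finally show ?thesis by (subst sum.swap)
  qed
  \<comment> \<open>\<open>cover\<close> says nothing about \<open>x = y\<close>. Since
    \<open>P\<close> and \<open>Q\<close> may overlap, the diagonal is counted separately, with
    weight at most 1 per vertex.\<close>
  have C: "(\<Sum>x\<in>P. \<Sum>y\<in>Q. if x = y then 1 else 0) \<le> real n"
  proof -
    have "(\<Sum>y\<in>Q. if x = y then 1 else 0) \<le> (1::real)" for x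
      using fin by (simp add: sum.delta)
    then have "(\<Sum>x\<in>P. \<Sum>y\<in>Q. if x = y then 1 else 0) \<le> real (card P) * 1"
      by (intro sum_bounded_above) auto
    then show ?thesis using card by simp
  qed
  have "(\<Sum>x\<in>P. ?a x) * (\<Sum>y\<in>Q. ?b y) = (\<Sum>x\<in>P. \<Sum>y\<in>Q. ?a x * ?b y)"
    by (rule sum_product)
  also have "\<dots> \<le> (\<Sum>x\<in>P. \<Sum>y\<in>Q. (if y \<in> D x then ?a x else 0) + (if x \<in> D' y then ?b y else 0)
      + (if x = y then 1 else 0))"
  proof (intro sum_mono)
    fix x y assume "x \<in> P" "y \<in> Q"
    then consider "x = y" | "y \<in> D x" | "x \<in> D' y" using cover by blast
    moreover have "?a x * ?b y \<le> ?a x * 1" "?a x * ?b y \<le> 1 * ?b y"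
      by (intro mult_left_mono mult_right_mono ab)+
    moreover note ab[of x] ab[of y]
    ultimately show "?a x * ?b y \<le> (if y \<in> D x then ?a x else 0) + (if x \<in> D' y then ?b y else 0)
      + (if x = y then 1 else 0)"
      by cases (auto split: if_splits)
  qed
  also have "\<dots> \<le> K * real n + K * real n + real n"
    unfolding sum.distrib by (intro add_mono A B C)
  finally have AB: "(\<Sum>x\<in>P. ?a x) * (\<Sum>y\<in>Q. ?b y) \<le> K * real n + K * real n + real n" .
  \<comment> \<open>Expanding the product gives 1, two single sums of at most \<open>n\<close> each,
    and a double sum of at most \<open>(2 * K + 1) * n\<close>; together at most
    \<open>(2 * K + 4) * n\<close>.\<close>
  have "(\<Sum>x\<in>P. ?a x) \<le> real (card P) * 1" "(\<Sum>y\<in>Q. ?b y) \<le> real (card Q) * 1"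
    by (intro sum_bounded_above ab)+
  then have "(\<Sum>x\<in>P. ?a x) \<le> real n" "(\<Sum>y\<in>Q. ?b y) \<le> real n" "1 \<le> real n"
    using card by simp_all
  with AB show ?thesis by (simp add: algebra_simps)
qed

lemma cliques_of_other_color:
  assumes "clique M E'" "E \<inter> E' = {}"
  shows "cliques M E = insert {} ((\<lambda>x. {x}) ` M)"
proof -
  have "S \<in> insert {} ((\<lambda>x. {x}) ` M)" if "S \<in> cliques M E" for S
  proof (cases "S = {}")
    case False
    then obtain x where x: "x \<in> S" by blast
    have "y = x" if "y \<in> S" for y
      using assms \<open>S \<in> cliques M E\<close> x that unfolding cliques_def clique_def by blast
    then have "S = {x}" using x by blast
    then show ?thesis using x \<open>S \<in> cliques M E\<close> by (auto simp: cliques_def)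
  qed simp
  then show ?thesis by (auto simp: cliques_def clique_def)
qed

text \<open>A clique of one color meets a clique of another in at most one vertex, so each sum is 1
  for the empty trace plus a sum over single vertices. An edge between \<open>M\<close> and
  \<open>M'\<close> is missing from \<open>E\<close> or from \<open>E'\<close>, which is the
  covering condition of \<open>half_graph_sum\<close>.\<close>

lemma crossing_pair_bound:
  fixes q K :: real
  assumes "finite V" "M \<in> cliques V E" "M' \<in> cliques V E'" "E \<inter> E' = {}" "card V = n" "1 \<le> n"
    and q: "0 \<le> q" "q \<le> 1" and K: "\<And>t. real t * q ^ t \<le> K"
  shows "(\<Sum>X\<in>cliques M' E. q ^ card (nonadj M E X)) * (\<Sum>X\<in>cliques M E'. q ^ card (nonadj M' E' X))
    \<le> (2 * K + 4) * real n"
proof -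
  have fin: "finite M" "finite M'"
    using assms(1-3) finite_clique_sets by metis+
  have sub: "M \<subseteq> V" "M' \<subseteq> V" "clique M E" "clique M' E'"
    using assms(2,3) by (auto simp: cliques_def)
  have expand: "(\<Sum>X\<in>cliques N F. f X) = f {} + (\<Sum>x\<in>N. f {x})"
    if "clique N F'" "F \<inter> F' = {}" "finite N" for N :: "'a set" and F F' and f :: "'a set \<Rightarrow> real"
    unfolding cliques_of_other_color[OF that(1,2)]
    using that(3) by (subst sum.insert) (auto simp: sum.reindex)
  have "(1 + (\<Sum>x\<in>M'. q ^ card (nonadj M E {x}))) * (1 + (\<Sum>y\<in>M. q ^ card (nonadj M' E' {y})))
    \<le> (2 * K + 4) * real n"
  proof (rule half_graph_sum)
    show "y \<in> nonadj M E {x} \<or> x \<in> nonadj M' E' {y}" if "x \<in> M'" "y \<in> M" "x \<noteq> y" for x y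
      using that assms(4) by (auto simp: nonadj_def insert_commute)
    show "card M' \<le> n" "card M \<le> n"
      using sub assms(1,5) card_mono by blast+
  qed (simp_all add: fin assms nonadj_subset flip: One_nat_def)
  moreover have "E' \<inter> E = {}" using assms(4) by blast
  ultimately show ?thesis
    using expand[OF sub(4) assms(4) fin(2)] expand[OF sub(3) _ fin(1)] by simp
qed

text \<open>Otherwise exchanging \<open>nonadj M E T\<close> for \<open>T\<close> would enlarge the maximum clique \<open>M\<close>.\<close>
lemma card_le_card_nonadj:
  assumes "finite V" "M \<in> cliques V E" and max: "\<And>S. S \<in> cliques V E \<Longrightarrow> card S \<le> card M"
    and "T \<in> cliques W E" "W \<subseteq> V - M"
  shows "card T \<le> card (nonadj M E T)"
proof -
  let ?D = "nonadj M E T"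
  have fin: "finite M" "finite T"
    using assms(1,2,4,5) finite_clique_sets finite_Diff finite_subset by metis+
  have TM: "T \<inter> M = {}" "T \<subseteq> V" using assms(4,5) by (auto simp: cliques_def)
  have "{x, y} \<in> E \<and> {y, x} \<in> E" if "x \<in> T" "y \<in> M - ?D" for x y
    using that TM by (auto simp: nonadj_def insert_commute)
  then have "(M - ?D) \<union> T \<in> cliques V E"
    using assms(2,4) TM by (auto simp: cliques_def clique_def)
  then have "card ((M - ?D) \<union> T) \<le> card M" by (rule max)
  moreover have "card ((M - ?D) \<union> T) = card (M - ?D) + card T"
    using fin TM by (intro card_Un_disjoint) auto
  moreover have "card (M - ?D) = card M - card ?D" "card ?D \<le> card M"
    using fin nonadj_subset[of M E T] finite_subset card_mono by (auto intro!: card_Diff_subset)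
  ultimately show ?thesis by linarith
qed

section \<open>Tuples of cliques outside the maximum cliques\<close>

lemma card_small_subsets:
  assumes "finite W"
  shows "card {X. X \<subseteq> W \<and> card X \<le> m} \<le> (card W + 1) ^ m"
proof -
  have "{X. X \<subseteq> W \<and> card X \<le> m} = (\<Union>k\<in>{..m}. {X. X \<subseteq> W \<and> card X = k})"
    by auto
  then have "card {X. X \<subseteq> W \<and> card X \<le> m} \<le> (\<Sum>k\<le>m. card {X. X \<subseteq> W \<and> card X = k})"
    using card_UN_le[of "{..m}"] by simp
  \<comment> \<open>The factor \<open>m choose k\<close> is at least 1 and is inserted to obtain the
    binomial expansion of \<open>(card W + 1) ^ m\<close>.\<close>
  also have "\<dots> \<le> (\<Sum>k\<le>m. (m choose k) * card W ^ k)"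
  proof (rule sum_mono)
    fix k assume "k \<in> {..m}"
    then have "1 \<le> m choose k" by (simp add: Suc_leI)
    moreover have "card {X. X \<subseteq> W \<and> card X = k} \<le> card W ^ k"
      using n_subsets[OF assms, of k] binomial_le_pow[of k "card W"] binomial_eq_0[of "card W" k]
      by (cases "k \<le> card W") auto
    ultimately show "card {X. X \<subseteq> W \<and> card X = k} \<le> (m choose k) * card W ^ k"
      by (metis mult_1 mult_le_mono)
  qed
  also have "\<dots> = (card W + 1) ^ m"
    by (simp only: binomial_ring[of "card W" 1 m]) simp
  finally show ?thesis .
qed

text \<open>As the unions agree, a vertex of \<open>S i - T i\<close> lies in some
  \<open>T j\<close> with \<open>j \<noteq> i\<close>, and \<open>S i\<close> meets each such
  \<open>T j\<close> in at most one vertex.\<close>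

lemma card_clique_Diff_le:
  assumes "finite I" "i \<in> I" "finite W"
    and disj: "\<And>i j. i \<in> I \<Longrightarrow> j \<in> I \<Longrightarrow> i \<noteq> j \<Longrightarrow> E i \<inter> E j = {}"
    and S: "\<And>i. i \<in> I \<Longrightarrow> S i \<in> cliques W (E i)" and T: "\<And>i. i \<in> I \<Longrightarrow> T i \<in> cliques W (E i)"
    and eq: "(\<Union>i\<in>I. S i) = (\<Union>i\<in>I. T i)"
  shows "card (S i - T i) \<le> card I"
proof -
  have le1: "card (S i \<inter> T j) \<le> 1" if "j \<in> I - {i}" for j
  proof -
    have "x = y" if "x \<in> S i \<inter> T j" "y \<in> S i \<inter> T j" for x y
      using S[OF \<open>i \<in> I\<close>] T[of j] disj[of i j] assms(2) \<open>j \<in> I - {i}\<close> that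
      unfolding cliques_def clique_def by blast
    then show ?thesis
      by (metis (no_types, lifting) One_nat_def card_le_Suc0_iff_eq card.infinite zero_le_one)
  qed
  have finT: "finite (T j)" if "j \<in> I" for j
    using T[OF that] assms(3) finite_clique_sets by metis
  have "S i - T i \<subseteq> (\<Union>j\<in>I - {i}. S i \<inter> T j)"
    using eq assms(2) by blast
  then have "card (S i - T i) \<le> card (\<Union>j\<in>I - {i}. S i \<inter> T j)"
    using assms(1) finT by (intro card_mono) auto
  also have "\<dots> \<le> (\<Sum>j\<in>I - {i}. card (S i \<inter> T j))"
    using assms(1) by (intro card_UN_le) auto
  also have "\<dots> \<le> (\<Sum>j\<in>I - {i}. 1)"
    by (intro sum_mono le1)
  also have "\<dots> \<le> card I"
    using assms(1) by (simp add: card_Diff_subset_Int)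
  finally show ?thesis .
qed

text \<open>Two tuples with the same union differ in few vertices, because cliques of different colors
  share at most one vertex.\<close>
lemma card_clique_tuples_with_union:
  assumes "finite I" "finite W"
    and disj: "\<And>i j. i \<in> I \<Longrightarrow> j \<in> I \<Longrightarrow> i \<noteq> j \<Longrightarrow> E i \<inter> E j = {}"
  shows "card {T \<in> PiE I (\<lambda>i. cliques W (E i)). (\<Union>i\<in>I. T i) = Z} \<le> (card W + 1) ^ (2 * card I ^ 2)"
    (is "card ?A \<le> _")
proof (cases "?A = {}")
  case False
  then obtain T0 where T0: "T0 \<in> ?A" by blast
  let ?S = "{X. X \<subseteq> W \<and> card X \<le> card I}"
  have finS: "finite ?S" using assms(2) by simp
  \<comment> \<open>Relative to the fixed tuple \<open>T0\<close>, a tuple is encoded by two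
    difference sets per color, each of size at most \<open>card I\<close>; hence the exponent
    \<open>2 * card I ^ 2\<close>.\<close>
  let ?f = "\<lambda>T. \<lambda>i\<in>I. (T i - T0 i, T0 i - T i)"
  have "card ?A \<le> card (PiE I (\<lambda>_. ?S \<times> ?S))"
  proof (rule card_inj_on_le[where f = ?f])
    show "inj_on ?f ?A"
    proof (rule inj_onI)
      fix S T assume S: "S \<in> ?A" and T: "T \<in> ?A" and eq: "?f S = ?f T"
      have "S i = T i" if "i \<in> I" for i
      proof -
        have "?f S i = ?f T i" using eq by simp
        then have "S i - T0 i = T i - T0 i" "T0 i - S i = T0 i - T i" using that by simp_all
        then show ?thesis by blast
      qed
      moreover have "S \<in> extensional I" "T \<in> extensional I"
        using S T by (simp_all add: PiE_def)
      ultimately show "S = T" by (intro extensionalityI)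
    qed
    show "?f ` ?A \<subseteq> PiE I (\<lambda>_. ?S \<times> ?S)"
    proof (rule image_subsetI)
      fix T assume T: "T \<in> ?A"
      have cl: "T i \<in> cliques W (E i)" "T0 i \<in> cliques W (E i)" if "i \<in> I" for i
        using T T0 that by (auto simp: PiE_mem)
      have eq: "(\<Union>i\<in>I. T i) = (\<Union>i\<in>I. T0 i)" using T T0 by simp
      have "card (T i - T0 i) \<le> card I" "card (T0 i - T i) \<le> card I" if "i \<in> I" for i
        using card_clique_Diff_le[of I i W E T T0] card_clique_Diff_le[of I i W E T0 T]
          assms that cl eq by auto
      then show "?f T \<in> PiE I (\<lambda>_. ?S \<times> ?S)"
        using cl by (fastforce simp: cliques_def)
    qed
    show "finite (PiE I (\<lambda>_. ?S \<times> ?S))"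
      using assms(1) finS by (intro finite_PiE) auto
  qed
  also have "\<dots> = (card ?S * card ?S) ^ card I"
    using assms(1) by (simp add: card_PiE card_cartesian_product)
  also have "\<dots> \<le> ((card W + 1) ^ card I * (card W + 1) ^ card I) ^ card I"
    using card_small_subsets[OF assms(2)] by (intro power_mono mult_le_mono) auto
  also have "\<dots> = (card W + 1) ^ (2 * card I ^ 2)"
    by (simp add: power_mult[symmetric] power_add[symmetric] power2_eq_square algebra_simps flip: mult_2)
  finally show ?thesis .
qed (metis card.empty zero_le)

text \<open>The tuples are grouped by their union \<open>Z\<close>. A tuple weighs at most
  \<open>q ^ card Z\<close>, each \<open>Z\<close> arises polynomially often, and the sum over all
  \<open>Z\<close> is \<open>(1 + q) ^ card W\<close>, whose base is below 2 once
  \<open>q < 1\<close>.\<close>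

lemma prod_sum_cliques_weighted:
  fixes q :: real
  assumes "finite I" "finite W" and q: "0 \<le> q" "q \<le> 1"
    and disj: "\<And>i j. i \<in> I \<Longrightarrow> j \<in> I \<Longrightarrow> i \<noteq> j \<Longrightarrow> E i \<inter> E j = {}"
  shows "(\<Prod>i\<in>I. \<Sum>T\<in>cliques W (E i). q ^ card T)
    \<le> real (card W + 1) ^ (2 * card I ^ 2) * (1 + q) ^ card W"
proof -
  let ?P = "PiE I (\<lambda>i. cliques W (E i))"
  let ?U = "\<lambda>T. \<Union>i\<in>I. T i"
  let ?N = "real (card W + 1) ^ (2 * card I ^ 2)"
  have finP: "finite ?P" using assms by (intro finite_PiE) auto
  have "(\<Prod>i\<in>I. \<Sum>T\<in>cliques W (E i). q ^ card T) = (\<Sum>T\<in>?P. \<Prod>i\<in>I. q ^ card (T i))"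
    using assms by (intro prod_sum_PiE) auto
  also have "\<dots> \<le> (\<Sum>T\<in>?P. q ^ card (?U T))"
  proof (rule sum_mono)
    fix T
    show "(\<Prod>i\<in>I. q ^ card (T i)) \<le> q ^ card (?U T)"
      using card_UN_le[OF assms(1), of T] q by (simp add: power_decreasing flip: power_sum)
  qed
  also have "\<dots> = (\<Sum>Z\<in>Pow W. \<Sum>T\<in>{T\<in>?P. ?U T = Z}. q ^ card (?U T))"
  proof (rule sum.group[symmetric])
    show "?U ` ?P \<subseteq> Pow W"
    proof clarify
      fix T i x assume "T \<in> ?P" "i \<in> I" "x \<in> T i"
      then show "x \<in> W" using PiE_mem[of T I "\<lambda>i. cliques W (E i)" i] by (auto simp: cliques_def)
    qed
  qed (use finP assms in auto)
  also have "\<dots> = (\<Sum>Z\<in>Pow W. real (card {T\<in>?P. ?U T = Z}) * q ^ card Z)"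
    by (intro sum.cong refl) simp
  also have "\<dots> \<le> (\<Sum>Z\<in>Pow W. ?N * q ^ card Z)"
  proof (intro sum_mono mult_right_mono)
    fix Z
    show "real (card {T\<in>?P. ?U T = Z}) \<le> ?N"
      unfolding of_nat_power[symmetric] of_nat_le_iff
      by (rule card_clique_tuples_with_union[OF assms(1,2) disj])
  qed (use q in auto)
  also have "\<dots> = ?N * (\<Sum>Z\<in>Pow W. q ^ card Z)"
    by (simp add: sum_distrib_left)
  also have "(\<Sum>Z\<in>Pow W. q ^ card Z) = (1 + q) ^ card W"
    using prod_add[OF assms(2), of "\<lambda>_. q" "\<lambda>_. 1"] by (simp add: add.commute)
  finally show ?thesis .
qed

section \<open>Assembling the upper bound\<close>

lemma poly_times_geometric_bounded:
  fixes x :: real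
  assumes "0 < x" "x < 1"
  shows "\<exists>K. \<forall>n. real (n + 1) ^ m * x ^ n \<le> K"
proof -
  have "((\<lambda>n. real (n + 1) ^ m * x ^ n) \<longlonglongrightarrow> 0)"
    using assms by real_asymp
  then have "Bseq (\<lambda>n. real (n + 1) ^ m * x ^ n)"
    by (meson convergentI convergent_imp_Bseq)
  then obtain K where "\<And>n. norm (real (n + 1) ^ m * x ^ n) \<le> K"
    unfolding Bseq_def by blast
  then show ?thesis by (metis abs_le_D1 real_norm_def)
qed

text \<open>Deleting the other sets from \<open>M i\<close> costs at most \<open>card I\<close>
  vertices and makes the sets disjoint. The bounded overcount keeps the power of 2 within a constant
  factor of \<open>2 ^ card V\<close>.\<close>

lemma sum_card_almost_disjoint:
  assumes "finite I" "finite V" "\<And>i. i \<in> I \<Longrightarrow> M i \<subseteq> V"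
    and le1: "\<And>i j. i \<in> I \<Longrightarrow> j \<in> I \<Longrightarrow> i \<noteq> j \<Longrightarrow> card (M i \<inter> M j) \<le> 1"
  shows "(\<Sum>i\<in>I. card (M i)) + card (V - (\<Union>i\<in>I. M i)) \<le> card V + card I ^ 2"
proof -
  let ?M = "\<lambda>i. M i - (\<Union>j\<in>I - {i}. M j)"
  have finM: "finite (M i)" if "i \<in> I" for i
    using assms that finite_subset by blast
  have "card (M i) \<le> card (?M i) + card I" if i: "i \<in> I" for i
  proof -
    have "M i = ?M i \<union> (\<Union>j\<in>I - {i}. M i \<inter> M j)" by blast
    then have "card (M i) \<le> card (?M i) + card (\<Union>j\<in>I - {i}. M i \<inter> M j)"
      by (metis card_Un_le)
    also have "card (\<Union>j\<in>I - {i}. M i \<inter> M j) \<le> (\<Sum>j\<in>I - {i}. card (M i \<inter> M j))"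
      using assms(1) by (intro card_UN_le) auto
    also have "\<dots> \<le> (\<Sum>j\<in>I - {i}. 1)"
      using i by (intro sum_mono le1) auto
    also have "\<dots> \<le> card I"
      using assms(1) by (simp add: card_Diff_subset_Int)
    finally show ?thesis by simp
  qed
  then have "(\<Sum>i\<in>I. card (M i)) \<le> (\<Sum>i\<in>I. card (?M i) + card I)"
    by (rule sum_mono)
  also have "\<dots> = (\<Sum>i\<in>I. card (?M i)) + card I ^ 2"
    by (simp add: sum.distrib power2_eq_square)
  also have "(\<Sum>i\<in>I. card (?M i)) = card (\<Union>i\<in>I. ?M i)"
    using assms(1) finM by (intro card_UN_disjoint[symmetric]) auto
  also have "\<dots> \<le> card (\<Union>i\<in>I. M i)"
    using assms(1) finM by (intro card_mono) auto
  finally have "(\<Sum>i\<in>I. card (M i)) \<le> card (\<Union>i\<in>I. M i) + card I ^ 2" by simp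
  moreover have "card (V - (\<Union>i\<in>I. M i)) = card V - card (\<Union>i\<in>I. M i)" "card (\<Union>i\<in>I. M i) \<le> card V"
    using assms finM by (auto intro!: card_Diff_subset card_mono)
  ultimately show ?thesis by linarith
qed

text \<open>In the square of the product, \<open>a i j\<close> can be paired with
  \<open>a j i\<close> over all ordered pairs with \<open>i \<noteq> j\<close>, and there are
  \<open>2 * (card I choose 2)\<close> of these.\<close>

lemma prod_off_diagonal_le:
  fixes a :: "'i \<Rightarrow> 'i \<Rightarrow> real"
  assumes "finite I" and nonneg: "\<And>i j. i \<in> I \<Longrightarrow> j \<in> I \<Longrightarrow> 0 \<le> a i j" and "0 \<le> D"
    and pair: "\<And>i j. i \<in> I \<Longrightarrow> j \<in> I \<Longrightarrow> i \<noteq> j \<Longrightarrow> a i j * a j i \<le> D"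
  shows "(\<Prod>i\<in>I. \<Prod>j\<in>I - {i}. a i j) \<le> D ^ (card I choose 2)"
proof (rule power2_le_imp_le)
  let ?b = "\<lambda>i j. if i = j then 1 else a i j"
  have eq: "(\<Prod>i\<in>I. \<Prod>j\<in>I - {i}. f i j) = (\<Prod>i\<in>I. \<Prod>j\<in>I. if i = j then 1 else f i j)"
    for f :: "'i \<Rightarrow> 'i \<Rightarrow> real"
    using assms(1) by (intro prod.cong refl prod.mono_neutral_cong_left) auto
  have "(\<Prod>i\<in>I. \<Prod>j\<in>I - {i}. a i j) = (\<Prod>i\<in>I. \<Prod>j\<in>I. if j = i then 1 else a j i)"
    unfolding eq by (rule prod.swap)
  also have "\<dots> = (\<Prod>i\<in>I. \<Prod>j\<in>I - {i}. a j i)"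
    unfolding eq by (simp add: eq_commute)
  finally have "(\<Prod>i\<in>I. \<Prod>j\<in>I - {i}. a i j)\<^sup>2 = (\<Prod>i\<in>I. \<Prod>j\<in>I - {i}. a i j * a j i)"
    by (simp add: power2_eq_square prod.distrib)
  also have "\<dots> \<le> (\<Prod>i\<in>I. \<Prod>j\<in>I - {i}. D)"
    using nonneg pair by (intro prod_mono conjI prod_nonneg mult_nonneg_nonneg ballI) auto
  also have "\<dots> = D ^ (card I * (card I - 1))"
    using assms(1) by (simp add: power_mult[symmetric] mult.commute)
  also have "card I * (card I - 1) = (card I choose 2) * 2"
    by (cases "card I") (auto simp: choose_two)
  finally show "(\<Prod>i\<in>I. \<Prod>j\<in>I - {i}. a i j)\<^sup>2 \<le> (D ^ (card I choose 2))\<^sup>2"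
    by (simp add: power_mult)
qed (use assms in auto)

lemma exists_max_clique:
  assumes "finite V"
  shows "\<exists>M\<in>cliques V E. \<forall>S\<in>cliques V E. card S \<le> card M"
proof -
  let ?C = "card ` cliques V E"
  have C: "finite ?C" "?C \<noteq> {}"
    using assms empty_in_cliques[of V E] by (auto simp del: empty_in_cliques)
  from Max_in[OF C] obtain M where "M \<in> cliques V E" "card M = Max ?C"
    by auto
  then have "\<forall>S\<in>cliques V E. card S \<le> card M"
    using Max_ge[OF C(1)] by simp
  with \<open>M \<in> cliques V E\<close> show ?thesis ..
qed

text \<open>The constant is built from \<open>card I\<close> alone, before \<open>V\<close> and
  \<open>E\<close> are given, which makes the bound uniform over all colorings.\<close>

lemma prod_num_cliques_upper:
  fixes I :: "'i set"
  assumes "finite I" "I \<noteq> {}"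
  obtains C :: real where "C > 0"
    "\<And>(V :: 'a set) E. finite V \<Longrightarrow> V \<noteq> {} \<Longrightarrow>
      (\<And>i j. i \<in> I \<Longrightarrow> j \<in> I \<Longrightarrow> i \<noteq> j \<Longrightarrow> E i \<inter> E j = {}) \<Longrightarrow>
      (\<Prod>i\<in>I. real (num_cliques V (E i))) \<le> C * real (card V) ^ (card I choose 2) * 2 ^ card V"
proof -
  define r where "r = card I"
  have r: "r \<ge> 1" using assms by (simp add: r_def Suc_leI card_gt_0_iff)
  \<comment> \<open>Each clique is split into \<open>r\<close> traces besides the one on its own
    maximum clique, so \<open>q ^ r = 1/2\<close> is what \<open>num_cliques_split\<close> asks
    for.\<close>
  define q :: real where "q = (1/2) powr (1 / real r)"
  have q: "0 < q" "q < 1"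
    using r powr_less_mono'[of "1/2" 0 "1 / real r"] by (auto simp: q_def)
  have qr: "q ^ r = 1/2"
    using r by (simp add: q_def powr_powr flip: powr_realpow)
  obtain K where "\<And>n. real (n + 1) ^ 1 * q ^ n \<le> K"
    using poly_times_geometric_bounded[OF q] by metis
  then have "real t * q ^ t \<le> K" for t
    using q by (intro order_trans[OF mult_right_mono, of "real t" "real (t + 1) ^ 1"]) auto
  note K = this
  have K0: "K \<ge> 0" using K[of 0] by simp
  have half: "0 < (1 + q) / 2" "(1 + q) / 2 < 1" using q by auto
  \<comment> \<open>Because \<open>(1 + q) / 2 < 1\<close>, the polynomial number of tuples per
    union is absorbed into a constant.\<close>
  obtain K' where K': "\<And>n. real (n + 1) ^ (2 * r\<^sup>2) * ((1 + q) / 2) ^ n \<le> K'"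
    using poly_times_geometric_bounded[OF half] by metis
  have K'1: "K' \<ge> 1" using K'[of 0] by simp
  \<comment> \<open>The factors come from the overlaps of the maximum cliques, from the tuples in
    \<open>W\<close>, and from the crossing pairs.\<close>
  define C where "C = 2 ^ r\<^sup>2 * K' * (2 * K + 4) ^ (r choose 2)"
  have C0: "C > 0" using K0 K'1 by (simp add: C_def)
  have bound: "(\<Prod>i\<in>I. real (num_cliques V (E i))) \<le> C * real (card V) ^ (card I choose 2) * 2 ^ card V"
    if "finite V" "V \<noteq> {}" and disj: "\<And>i j. i \<in> I \<Longrightarrow> j \<in> I \<Longrightarrow> i \<noteq> j \<Longrightarrow> E i \<inter> E j = {}"
    for V :: "'a set" and E
  proof -
    define n where "n = card V"
    have n1: "n \<ge> 1" using that by (simp add: n_def Suc_leI card_gt_0_iff)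
    have "\<forall>i. \<exists>M. M \<in> cliques V (E i) \<and> (\<forall>S\<in>cliques V (E i). card S \<le> card M)"
      using exists_max_clique[OF \<open>finite V\<close>] by blast
    then obtain M where M: "\<And>i. M i \<in> cliques V (E i)"
      and maxM: "\<And>i S. S \<in> cliques V (E i) \<Longrightarrow> card S \<le> card (M i)"
      by metis
    have MV: "M i \<subseteq> V" and clM: "clique (M i) (E i)" and finM: "finite (M i)" for i
      using M[of i] finite_clique_sets[OF \<open>finite V\<close> M[of i]] by (simp_all add: cliques_def)
    define W where "W = V - (\<Union>i\<in>I. M i)"
    have finW: "finite W" using \<open>finite V\<close> by (simp add: W_def)
    define A where "A i j = (\<Sum>X\<in>cliques (M j) (E i). q ^ card (nonadj (M i) (E i) X))" for i j
    define B where "B i = (\<Sum>X\<in>cliques W (E i). q ^ card (nonadj (M i) (E i) X))" for i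
    have A0: "A i j \<ge> 0" and B0: "B i \<ge> 0" for i j
      using q by (auto simp: A_def B_def intro!: sum_nonneg)
    have split: "real (num_cliques V (E i)) \<le> 2 ^ card (M i) * (B i * (\<Prod>j\<in>I - {i}. A i j))"
      if i: "i \<in> I" for i
    proof -
      \<comment> \<open>\<open>M i\<close> is treated separately, so the index \<open>i\<close> is
        free and carries the remainder \<open>W\<close>.\<close>
      let ?R = "\<lambda>j. if j = i then W else M j"
      let ?S = "\<lambda>Y. \<Sum>X\<in>cliques Y (E i). q ^ card (nonadj (M i) (E i) X)"
      have cover: "V \<subseteq> M i \<union> (\<Union>j\<in>I. ?R j)"
        using i unfolding W_def by auto
      have "real (num_cliques V (E i)) \<le> 2 ^ card (M i) * (\<Prod>j\<in>I. ?S (?R j))"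
        by (rule num_cliques_split[OF \<open>finite V\<close> finM assms(1) r_def[symmetric] cover])
          (use finM finW q qr in auto)
      also have "(\<Prod>j\<in>I. ?S (?R j)) = ?S (?R i) * (\<Prod>j\<in>I - {i}. ?S (?R j))"
        using assms(1) i by (rule prod.remove)
      also have "\<dots> = B i * (\<Prod>j\<in>I - {i}. A i j)"
        unfolding A_def B_def by (intro arg_cong2[where f = "(*)"] prod.cong refl) auto
      finally show ?thesis .
    qed
    have "(\<Prod>i\<in>I. B i) \<le> (\<Prod>i\<in>I. \<Sum>T\<in>cliques W (E i). q ^ card T)"
    proof (intro prod_mono conjI B0)
      fix i assume i: "i \<in> I"
      show "B i \<le> (\<Sum>T\<in>cliques W (E i). q ^ card T)"
        unfolding B_def
      proof (intro sum_mono power_decreasing)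
        fix T assume "T \<in> cliques W (E i)"
        then show "card T \<le> card (nonadj (M i) (E i) T)"
          using i by (intro card_le_card_nonadj[OF \<open>finite V\<close> M maxM]) (auto simp: W_def)
      qed (use q in auto)
    qed
    also have "\<dots> \<le> real (card W + 1) ^ (2 * card I ^ 2) * (1 + q) ^ card W"
      using prod_sum_cliques_weighted[OF assms(1) finW _ _ disj] q by simp
    also have "\<dots> = real (card W + 1) ^ (2 * r\<^sup>2) * ((1 + q) / 2) ^ card W * 2 ^ card W"
      by (simp add: r_def power_divide)
    also have "\<dots> \<le> K' * 2 ^ card W"
      using K' by (intro mult_right_mono) auto
    finally have prodB: "(\<Prod>i\<in>I. B i) \<le> K' * 2 ^ card W" .
    have prodA: "(\<Prod>i\<in>I. \<Prod>j\<in>I - {i}. A i j) \<le> ((2 * K + 4) * real n) ^ (card I choose 2)"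
    proof (rule prod_off_diagonal_le[OF assms(1) A0])
      show "A i j * A j i \<le> (2 * K + 4) * real n" if "i \<in> I" "j \<in> I" "i \<noteq> j" for i j
        unfolding A_def using K n1 q disj[OF that]
        by (intro crossing_pair_bound[OF \<open>finite V\<close> M M]) (auto simp: n_def)
    qed (use K0 in auto)
    have size: "(\<Sum>i\<in>I. card (M i)) + card W \<le> n + r\<^sup>2"
      unfolding W_def n_def r_def
    proof (rule sum_card_almost_disjoint[OF assms(1) \<open>finite V\<close> MV])
      fix i j assume "i \<in> I" "j \<in> I" "i \<noteq> j"
      then have "x = y" if "x \<in> M i \<inter> M j" "y \<in> M i \<inter> M j" for x y
        using that clM[of i] clM[of j] disj[of i j] unfolding clique_def by blast
      then show "card (M i \<inter> M j) \<le> 1"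
        using finM by (simp add: card_le_Suc0_iff_eq)
    qed
    have "(\<Prod>i\<in>I. real (num_cliques V (E i)))
        \<le> (\<Prod>i\<in>I. 2 ^ card (M i) * (B i * (\<Prod>j\<in>I - {i}. A i j)))"
      by (intro prod_mono) (use split in auto)
    also have "\<dots> = 2 ^ (\<Sum>i\<in>I. card (M i)) * ((\<Prod>i\<in>I. B i) * (\<Prod>i\<in>I. \<Prod>j\<in>I - {i}. A i j))"
      by (simp add: prod.distrib power_sum)
    also have "\<dots> \<le> 2 ^ (\<Sum>i\<in>I. card (M i)) * ((K' * 2 ^ card W) * ((2 * K + 4) * real n) ^ (card I choose 2))"
      using K'1 by (intro mult_left_mono mult_mono prodB prodA prod_nonneg ballI A0) auto
    also have "\<dots> = 2 ^ ((\<Sum>i\<in>I. card (M i)) + card W) * (K' * (2 * K + 4) ^ (r choose 2) * real n ^ (r choose 2))"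
      by (simp add: power_add power_mult_distrib r_def mult_ac)
    also have "\<dots> \<le> 2 ^ (n + r\<^sup>2) * (K' * (2 * K + 4) ^ (r choose 2) * real n ^ (r choose 2))"
      using size K0 K'1 by (intro mult_right_mono power_increasing) auto
    also have "\<dots> = C * real (card V) ^ (card I choose 2) * 2 ^ card V"
      by (simp add: C_def n_def r_def power_add mult_ac)
    finally show ?thesis .
  qed
  show thesis by (rule that[OF C0 bound])
qed

lemma clique_product_upper:
  assumes "r \<ge> 1"
  shows "\<exists>C>0. \<forall>n\<ge>1. \<forall>c. real (clique_product r n c) \<le> C * real n ^ (r choose 2) * 2 ^ n"
proof -
  have I: "finite {1..r}" "{1..r} \<noteq> {}" using assms by auto
  obtain C where C: "C > 0" and bound: "\<And>(V :: nat set) E. finite V \<Longrightarrow> V \<noteq> {} \<Longrightarrow>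
    (\<And>i j. i \<in> {1..r} \<Longrightarrow> j \<in> {1..r} \<Longrightarrow> i \<noteq> j \<Longrightarrow> E i \<inter> E j = {}) \<Longrightarrow>
    (\<Prod>i\<in>{1..r}. real (num_cliques V (E i))) \<le> C * real (card V) ^ (card {1..r} choose 2) * 2 ^ card V"
    by (rule prod_num_cliques_upper[OF I, where 'a = nat]) blast
  have "real (clique_product r n c) \<le> C * real n ^ (r choose 2) * 2 ^ n" if "n \<ge> 1" for n c
  proof -
    have "(\<Prod>i\<in>{1..r}. real (num_cliques {..<n} (color_class n c i)))
      \<le> C * real (card {..<n}) ^ (card {1..r} choose 2) * 2 ^ card {..<n}"
      using that by (intro bound) (auto simp: color_class_def lessThan_empty_iff)
    then show ?thesis by (simp add: clique_product_def)
  qed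
  then show ?thesis using C by blast
qed

section \<open>A coloring attaining the upper bound\<close>

text \<open>The last base \<open>r\<close> digit of \<open>v\<close>, shifted into
  \<open>{1..r}\<close>; \<open>target\<close> is the digit before it. Being independent digits,
  they make every combination of level and target occur about equally often.\<close>

definition level :: "nat \<Rightarrow> nat \<Rightarrow> nat" where
  "level r v = v mod r + 1"

definition target :: "nat \<Rightarrow> nat \<Rightarrow> nat" where
  "target r v = v div r mod r + 1"

text \<open>An edge inside a level gets that level as its color, an edge between two levels gets the
  target of its upper endpoint. So level \<open>i\<close> together with one vertex of target \<open>i\<close> from each
  higher level is a clique of color \<open>i\<close>. The \<open>THE\<close> is only used when the levels differ,
  where it is well defined.\<close>
definition level_coloring :: "nat \<Rightarrow> nat set \<Rightarrow> nat" where
  "level_coloring r e =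
    (let m = Max (level r ` e) in
     if level r ` e = {m} then m else target r (THE v. v \<in> e \<and> level r v = m))"

lemma level_coloring_same: "level r u = level r v \<Longrightarrow> level_coloring r {u, v} = level r u"
  by (simp add: level_coloring_def)

lemma level_coloring_less:
  assumes "level r u < level r v"
  shows "level_coloring r {u, v} = target r v" "level_coloring r {v, u} = target r v"
proof -
  have "Max (level r ` {u, v}) = level r v" "level r ` {u, v} \<noteq> {level r v}"
    using assms by auto
  moreover have "(THE w. w \<in> {u, v} \<and> level r w = level r v) = v"
    using assms by (intro the_equality) auto
  ultimately show *: "level_coloring r {u, v} = target r v"
    by (simp add: level_coloring_def Let_def)
  then show "level_coloring r {v, u} = target r v"
    by (simp add: insert_commute)
qed

lemma level_coloring_in_edge_colorings:
  assumes "r \<ge> 1"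
  shows "level_coloring r \<in> edge_colorings r n"
  unfolding edge_colorings_def
proof (rule funcsetI)
  fix e assume "e \<in> [{..<n}]\<^bsup>2\<^esup>"
  then obtain u v where e: "e = {u, v}"
    by (auto simp: nsets_def card_2_iff)
  have range: "level r w \<in> {1..r}" "target r w \<in> {1..r}" for w
    using assms by (auto simp: level_def target_def Suc_le_eq)
  consider "level r u = level r v" | "level r u < level r v" | "level r v < level r u"
    by linarith
  then show "level_coloring r e \<in> {1..r}"
    by cases (use range in \<open>simp_all only: e level_coloring_same level_coloring_less\<close>)
qed

text \<open>Any subset of level \<open>i\<close> may be combined with one vertex of target
  \<open>i\<close> from each of the \<open>r - i\<close> higher levels. The resulting clique
  determines these choices because the levels are disjoint.\<close>

lemma num_cliques_level_coloring:
  assumes m: "\<And>j. j \<in> {i<..r} \<Longrightarrow> m \<le> card {v. v < n \<and> level r v = j \<and> target r v = i}"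
  shows "2 ^ card {v. v < n \<and> level r v = i} * m ^ (r - i)
    \<le> num_cliques {..<n} (color_class n (level_coloring r) i)"
proof -
  let ?A = "{v. v < n \<and> level r v = i}"
  let ?B = "\<lambda>j. {v. v < n \<and> level r v = j \<and> target r v = i}"
  let ?J = "{i<..r}"
  let ?P = "Pow ?A \<times> PiE ?J ?B"
  let ?f = "\<lambda>(S, w). S \<union> w ` ?J"
  have "2 ^ card ?A * m ^ (r - i) = 2 ^ card ?A * (\<Prod>j\<in>?J. m)"
    by simp
  also have "\<dots> \<le> 2 ^ card ?A * (\<Prod>j\<in>?J. card (?B j))"
    by (intro mult_le_mono prod_mono) (use m in auto)
  also have "\<dots> = card ?P"
    by (simp add: card_cartesian_product card_Pow card_PiE)
  also have "\<dots> \<le> num_cliques {..<n} (color_class n (level_coloring r) i)"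
    unfolding num_cliques_eq
  proof (rule card_inj_on_le[where f = ?f])
    have w: "w j < n" "level r (w j) = j" "target r (w j) = i" if "w \<in> PiE ?J ?B" "j \<in> ?J" for w j
      using PiE_mem[OF that] by auto
    show "inj_on ?f ?P"
    proof (rule inj_onI, clarify)
      fix S w S' w'
      assume S: "S \<subseteq> ?A" "S' \<subseteq> ?A" and ww: "w \<in> PiE ?J ?B" "w' \<in> PiE ?J ?B"
        and eq: "S \<union> w ` ?J = S' \<union> w' ` ?J"
      have "w j \<notin> ?A" "w' j \<notin> ?A" if "j \<in> ?J" for j
        using w(2)[OF ww(1) that] w(2)[OF ww(2) that] that by auto
      then have "S = (S \<union> w ` ?J) \<inter> ?A" "S' = (S' \<union> w' ` ?J) \<inter> ?A"
        using S by blast+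
      then have "S = S'" using eq by simp
      moreover have "w j = w' j" if j: "j \<in> ?J" for j
      proof -
        have "w j \<in> S' \<union> w' ` ?J" using j eq by blast
        moreover have "w j \<notin> S'" using w[OF ww(1) j] j S by auto
        ultimately obtain k where "k \<in> ?J" "w j = w' k" by blast
        then show ?thesis using w[OF ww(1) j] w[OF ww(2), of k] by metis
      qed
      then have "w = w'" using ww by (intro PiE_ext) auto
      ultimately show "S = S' \<and> w = w'" by blast
    qed
    show "?f ` ?P \<subseteq> cliques {..<n} (color_class n (level_coloring r) i)"
    proof clarify
      fix S w assume S: "S \<subseteq> ?A" and ww: "w \<in> PiE ?J ?B"
      let ?U = "S \<union> w ` ?J"
      \<comment> \<open>Above level \<open>i\<close> the level determines the vertex, so two
        distinct vertices of equal level must lie in level \<open>i\<close>.\<close>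
      have U: "z < n" "level r z = i \<or> level r z > i \<and> target r z = i \<and> z = w (level r z)"
        if "z \<in> ?U" for z
        using that S w[OF ww] by auto
      have "level_coloring r {x, y} = i" if "x \<in> ?U" "y \<in> ?U" "x \<noteq> y" for x y
      proof -
        consider "level r x = level r y" | "level r x < level r y" | "level r y < level r x"
          by linarith
        then show ?thesis
        proof cases
          case 1
          with U(2)[OF that(1)] U(2)[OF that(2)] that(3) have "level r x = i" by metis
          with 1 show ?thesis by (simp add: level_coloring_same)
        next
          case 2
          with U(2)[OF that(1)] U(2)[OF that(2)] have "target r y = i" by auto
          with 2 show ?thesis by (simp add: level_coloring_less)
        next
          case 3
          with U(2)[OF that(1)] U(2)[OF that(2)] have "target r x = i" by auto
          with 3 show ?thesis by (simp add: level_coloring_less)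
        qed
      qed
      with U(1) show "?U \<in> cliques {..<n} (color_class n (level_coloring r) i)"
        unfolding cliques_def clique_def color_class_def nsets_def by fastforce
    qed
  qed simp
  finally show ?thesis .
qed

lemma card_level_target:
  assumes "i \<in> {1..r}" "j \<in> {1..r}"
  shows "n div r\<^sup>2 \<le> card {v. v < n \<and> level r v = j \<and> target r v = i}"
proof -
  \<comment> \<open>The number with last base \<open>r\<close> digits \<open>i - 1\<close> and
    \<open>j - 1\<close>, preceded by the digits of \<open>t\<close>.\<close>
  let ?f = "\<lambda>t. (j - 1) + r * ((i - 1) + r * t)"
  have r: "r \<ge> 1" using assms by simp
  have "card {..<n div r\<^sup>2} \<le> card {v. v < n \<and> level r v = j \<and> target r v = i}"
  proof (rule card_inj_on_le[where f = ?f])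
    show "inj_on ?f {..<n div r\<^sup>2}"
      using r by (intro inj_onI) auto
    show "?f ` {..<n div r\<^sup>2} \<subseteq> {v. v < n \<and> level r v = j \<and> target r v = i}"
    proof clarify
      fix t assume t: "t < n div r\<^sup>2"
      have "(i - 1) + r * t + 1 \<le> r * (t + 1)"
        using assms by (simp add: algebra_simps)
      then have "r * ((i - 1) + r * t + 1) \<le> r * (r * (t + 1))"
        by (rule mult_le_mono2)
      moreover have "?f t < r * ((i - 1) + r * t + 1)"
      proof -
        have "j - 1 < r" using assms by auto
        then show ?thesis by (simp add: distrib_left)
      qed
      ultimately have "?f t < r * (r * (t + 1))"
        by (rule less_le_trans[rotated])
      also have "\<dots> \<le> r\<^sup>2 * (n div r\<^sup>2)"
        using t by (simp add: power2_eq_square mult.assoc del: mult_Suc_right)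
      also have "\<dots> \<le> n" by (simp add: times_div_less_eq_dividend)
      finally have "?f t < n" .
      moreover have "level r (?f t) = j" "target r (?f t) = i"
      proof -
        have less: "j - 1 < r" "i - 1 < r" and r0: "r \<noteq> 0" using assms by auto
        have "?f t mod r = j - 1"
          unfolding mod_mult_self2 using less(1) by (rule mod_less)
        moreover have "?f t div r mod r = i - 1"
          unfolding div_mult_self2[OF r0] div_less[OF less(1)] add_0_right mod_mult_self2
          using less(2) by (rule mod_less)
        moreover have "j - 1 + 1 = j" "i - 1 + 1 = i"
          using assms by auto
        ultimately show "level r (?f t) = j" "target r (?f t) = i"
          unfolding level_def target_def by (simp_all only:)
      qed
      ultimately show "?f t < n \<and> level r (?f t) = j \<and> target r (?f t) = i" by blast
    qed
  qed simp
  then show ?thesis by simp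
qed

lemma sum_diff_choose_two: "(\<Sum>i = 1..r. r - i) = r choose 2"
proof (induction r)
  case (Suc r)
  have "(\<Sum>i = 1..Suc r. Suc r - i) = (\<Sum>i = 1..r. Suc r - i)"
    by simp
  also have "\<dots> = (\<Sum>i = 1..r. (r - i) + 1)"
    by (intro sum.cong refl) (auto simp: Suc_diff_le)
  also have "\<dots> = (r choose 2) + r"
    unfolding sum.distrib Suc by simp
  finally show ?case by (simp add: numeral_2_eq_2)
qed simp

lemma sum_card_levels:
  assumes "r \<ge> 1"
  shows "(\<Sum>i = 1..r. card {v. v < n \<and> level r v = i}) = n"
proof -
  have "(\<Sum>i = 1..r. card {v. v < n \<and> level r v = i}) = card (\<Union>i\<in>{1..r}. {v. v < n \<and> level r v = i})"
    by (intro card_UN_disjoint[symmetric]) auto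
  also have "(\<Union>i\<in>{1..r}. {v. v < n \<and> level r v = i}) = {..<n}"
    using assms by (auto simp: level_def Suc_le_eq)
  finally show ?thesis by simp
qed

text \<open>The levels partition the vertices, which gives \<open>2 ^ n\<close>, and the exponents
  \<open>r - i\<close> add up to \<open>r choose 2\<close>.\<close>

lemma clique_product_level_coloring:
  assumes "r \<ge> 1"
  shows "2 ^ n * (n div r\<^sup>2) ^ (r choose 2) \<le> clique_product r n (level_coloring r)"
proof -
  have "2 ^ n * (n div r\<^sup>2) ^ (r choose 2)
    = (\<Prod>i = 1..r. 2 ^ card {v. v < n \<and> level r v = i} * (n div r\<^sup>2) ^ (r - i))"
    using sum_card_levels[OF assms, of n] sum_diff_choose_two[of r]
    by (simp add: prod.distrib flip: power_sum)
  also have "\<dots> \<le> clique_product r n (level_coloring r)"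
    unfolding clique_product_def
    by (intro prod_mono conjI num_cliques_level_coloring card_level_target) auto
  finally show ?thesis .
qed

lemma clique_product_pos: "clique_product r n c \<ge> 1"
  unfolding clique_product_def using num_cliques_pos[of "{..<n}"]
  by (simp add: Suc_le_eq prod_pos)

lemma exists_large_clique_product:
  assumes "r \<ge> 1"
  shows "\<exists>C::real. C > 0 \<and> (\<forall>n\<ge>1. \<exists>c \<in> edge_colorings r n.
    real (clique_product r n c) \<ge> C * real n ^ (r choose 2) * 2 ^ n)"
proof -
  define s where "s = real (r\<^sup>2)"
  have s: "s \<ge> 1" using assms by (simp add: s_def)
  let ?k = "r choose 2"
  \<comment> \<open>The factor \<open>2 ^ r\<^sup>2\<close> pushes the bound below 1 when
    \<open>n < r\<^sup>2\<close>. For larger \<open>n\<close>, rounding in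
    \<open>n div r\<^sup>2\<close> loses at most a factor 2, hence the \<open>2 * s\<close>.\<close>
  let ?C = "1 / ((2 * s) ^ ?k * 2 ^ r\<^sup>2)"
  have "real (clique_product r n (level_coloring r)) \<ge> ?C * real n ^ ?k * 2 ^ n"
    for n
  proof (cases "n < r\<^sup>2")
    case True
    then have "real n \<le> s" by (simp only: s_def of_nat_le_iff)
    then have "real n \<le> 2 * s" using s by simp
    then have "real n ^ ?k \<le> (2 * s) ^ ?k" by (rule power_mono) simp
    moreover have "(2::real) ^ n \<le> 2 ^ r\<^sup>2"
      using True by (intro power_increasing) auto
    ultimately have "real n ^ ?k * 2 ^ n \<le> (2 * s) ^ ?k * 2 ^ r\<^sup>2"
      using s by (intro mult_mono) auto
    then have "?C * real n ^ ?k * 2 ^ n \<le> 1"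
      using s by (simp add: divide_le_eq)
    also have "1 \<le> real (clique_product r n (level_coloring r))"
      using clique_product_pos[of r n "level_coloring r"] by linarith
    finally show ?thesis .
  next
    case False
    define m where "m = n div r\<^sup>2"
    have m1: "m \<ge> 1" using False assms by (simp add: m_def Suc_le_eq div_greater_zero_iff)
    have "n < r\<^sup>2 * (m + 1)"
      using assms by (simp add: m_def dividend_less_times_div)
    also have "\<dots> \<le> r\<^sup>2 * (2 * m)" using m1 by (intro mult_le_mono2) simp
    finally have "real n \<le> real (r\<^sup>2 * (2 * m))" by (simp only: of_nat_le_iff)
    then have "real n \<le> (2 * s) * real m" by (simp add: s_def mult_ac)
    then have "real n ^ ?k \<le> ((2 * s) * real m) ^ ?k" by (intro power_mono) auto
    then have "real n ^ ?k / (2 * s) ^ ?k \<le> real m ^ ?k"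
      using s by (simp add: divide_le_eq power_mult_distrib mult_ac)
    then have "(real n ^ ?k / (2 * s) ^ ?k) * (2 ^ n / 2 ^ r\<^sup>2) \<le> real m ^ ?k * 2 ^ n"
      by (intro mult_mono) (auto simp: divide_le_eq)
    also have "\<dots> = real (2 ^ n * m ^ ?k)" by simp
    also have "\<dots> \<le> real (clique_product r n (level_coloring r))"
      unfolding of_nat_le_iff m_def by (rule clique_product_level_coloring[OF assms])
    finally show ?thesis by simp
  qed
  moreover have "?C > 0" using s by simp
  ultimately show ?thesis
    using level_coloring_in_edge_colorings[OF assms] by blast
qed

section \<open>Random three-colorings\<close>

text \<open>The expected number of cliques of one fixed color in a uniformly random 3-coloring. Three
  colors are optimal because \<open>r / ln r\<close> is smallest at \<open>r = 3\<close> among the integers.\<close>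
definition clique_weight :: "nat \<Rightarrow> real" where
  "clique_weight n = (\<Sum>S\<in>Pow {..<n}. (1/3) ^ (card S choose 2))"

text \<open>The edges inside \<open>S\<close> are forced to color \<open>i\<close>, and every other
  edge keeps three choices.\<close>

lemma card_colorings_monochromatic:
  fixes n i :: nat
  assumes "S \<subseteq> {..<n}" "i \<in> {1..3}"
  shows "real (card {c \<in> PiE ([{..<n}]\<^bsup>2\<^esup>) (\<lambda>_. {1..3}). clique S (color_class n c i)})
    = 3 ^ card ([{..<n}]\<^bsup>2\<^esup>) * (1/3) ^ (card S choose 2)"
proof -
  let ?E = "[{..<n}]\<^bsup>2\<^esup>" and ?F = "[S]\<^bsup>2\<^esup>"
  have finE: "finite ?E" by (simp add: finite_imp_finite_nsets)
  have FE: "?F \<subseteq> ?E" using assms(1) by (rule nsets_mono)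
  have mono: "clique S (color_class n c i) \<longleftrightarrow> (\<forall>e\<in>?F. c e = i)" for c
  proof -
    have "clique S (color_class n c i) \<longleftrightarrow> ?F \<subseteq> color_class n c i"
      unfolding clique_def nsets_def card_2_iff by fastforce
    then show ?thesis using FE unfolding color_class_def by blast
  qed
  have "{c \<in> PiE ?E (\<lambda>_. {1..3}). clique S (color_class n c i)}
      = PiE ?E (\<lambda>e. if e \<in> ?F then {i} else {1..3})"
  proof (rule set_eqI)
    fix c
    show "c \<in> {c \<in> PiE ?E (\<lambda>_. {1..3}). clique S (color_class n c i)}
      \<longleftrightarrow> c \<in> PiE ?E (\<lambda>e. if e \<in> ?F then {i} else {1..3})"
      using assms(2) FE unfolding mem_Collect_eq mono PiE_iff
      by (auto split: if_splits)
  qed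
  then have "card {c \<in> PiE ?E (\<lambda>_. {1..3}). clique S (color_class n c i)}
      = (\<Prod>e\<in>?E. card (if e \<in> ?F then {i} else {1..3}))"
    by (simp only: card_PiE[OF finE])
  also have "\<dots> = (\<Prod>e\<in>?E - ?F. 3)"
    using finE by (intro prod.mono_neutral_cong_right) auto
  also have "\<dots> = 3 ^ (card ?E - card ?F)"
    using finite_subset[OF FE finE] FE by (simp add: card_Diff_subset)
  finally have "real (card {c \<in> PiE ?E (\<lambda>_. {1..3}). clique S (color_class n c i)})
    = 3 ^ (card ?E - card ?F)" by simp
  also have "\<dots> = 3 ^ card ?E / 3 ^ card ?F"
    using card_mono[OF finE FE] by (simp add: power_diff)
  also have "\<dots> = 3 ^ card ?E * (1/3) ^ (card S choose 2)"
    by (simp add: power_one_over)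
  finally show ?thesis .
qed

text \<open>First moment method for the sum of the three clique counts: a coloring that is at most
  average for the sum controls all three colors at once, which costs the factor 3.\<close>

lemma exists_three_coloring:
  "\<exists>c \<in> [{..<n}]\<^bsup>2\<^esup> \<rightarrow> {1..3}. \<forall>i\<in>{1..3}.
    real (num_cliques {..<n} (color_class n c i)) \<le> 3 * clique_weight n"
proof -
  let ?E = "[{..<n}]\<^bsup>2\<^esup>"
  let ?\<Omega> = "PiE ?E (\<lambda>_. {1..3::nat})"
  let ?k = "\<lambda>c i. real (num_cliques {..<n} (color_class n c i))"
  have finE: "finite ?E" by (simp add: finite_imp_finite_nsets)
  then have fin: "finite ?\<Omega>" by (intro finite_PiE) auto
  have card\<Omega>: "real (card ?\<Omega>) = 3 ^ card ?E" using finE by (simp add: card_PiE)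
  have "(\<Sum>c\<in>?\<Omega>. ?k c i) = 3 ^ card ?E * clique_weight n" if i: "i \<in> {1..3}" for i
  proof -
    have "(\<Sum>c\<in>?\<Omega>. ?k c i) = (\<Sum>c\<in>?\<Omega>. \<Sum>S\<in>Pow {..<n}. if clique S (color_class n c i) then 1 else 0)"
    proof (rule sum.cong[OF refl])
      fix c
      have "{S. S \<subseteq> {..<n} \<and> clique S (color_class n c i)}
        = Pow {..<n} \<inter> {S. clique S (color_class n c i)}" by blast
      then show "?k c i = (\<Sum>S\<in>Pow {..<n}. if clique S (color_class n c i) then 1 else 0)"
        by (simp add: num_cliques_def sum.If_cases)
    qed
    also have "\<dots> = (\<Sum>S\<in>Pow {..<n}. \<Sum>c\<in>?\<Omega>. if clique S (color_class n c i) then 1 else 0)"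
      by (rule sum.swap)
    also have "\<dots> = (\<Sum>S\<in>Pow {..<n}. real (card {c \<in> ?\<Omega>. clique S (color_class n c i)}))"
      using fin by (intro sum.cong refl) (simp flip: sum.inter_filter)
    also have "\<dots> = (\<Sum>S\<in>Pow {..<n}. 3 ^ card ?E * (1/3) ^ (card S choose 2))"
      by (intro sum.cong refl card_colorings_monochromatic i) auto
    finally show ?thesis by (simp add: clique_weight_def sum_distrib_left)
  qed
  then have "(\<Sum>i\<in>{1..3}. \<Sum>c\<in>?\<Omega>. ?k c i) = 3 * (3 ^ card ?E * clique_weight n)"
    by simp
  then have total: "(\<Sum>c\<in>?\<Omega>. \<Sum>i\<in>{1..3}. ?k c i) = real (card ?\<Omega>) * (3 * clique_weight n)"
    by (subst sum.swap) (simp only: card\<Omega> mult.left_commute)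
  have "\<exists>c\<in>?\<Omega>. (\<Sum>i\<in>{1..3}. ?k c i) \<le> 3 * clique_weight n"
  proof (rule ccontr)
    assume "\<not> ?thesis"
    then have "(\<Sum>c\<in>?\<Omega>. 3 * clique_weight n) < (\<Sum>c\<in>?\<Omega>. \<Sum>i\<in>{1..3}. ?k c i)"
      using fin by (intro sum_strict_mono) (auto simp: PiE_eq_empty_iff not_le)
    then show False using total by simp
  qed
  then obtain c where c: "c \<in> ?\<Omega>" "(\<Sum>i\<in>{1..3}. ?k c i) \<le> 3 * clique_weight n" by blast
  have "?k c i \<le> (\<Sum>i\<in>{1..3}. ?k c i)" if "i \<in> {1..3}" for i
    using that by (intro member_le_sum) auto
  with c show ?thesis by (intro bexI[of _ c]) (force simp: PiE_def)+
qed

text \<open>Grouped by size, the weight is a sum of \<open>n + 1\<close> terms. Each is at most the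
  exponential of a quadratic in \<open>k\<close>, whose maximum is found by completing the
  square.\<close>

lemma clique_weight_le:
  assumes "n \<ge> 1"
  shows "clique_weight n \<le> real (n + 1) * exp ((ln (real n) + ln 3 / 2)\<^sup>2 / (2 * ln 3))"
proof -
  let ?Y = "exp ((ln (real n) + ln 3 / 2)\<^sup>2 / (2 * ln 3))"
  have "clique_weight n = (\<Sum>k\<in>{..n}. \<Sum>S\<in>{S\<in>Pow {..<n}. card S = k}. (1/3) ^ (card S choose 2))"
    unfolding clique_weight_def
    by (rule sum.group[symmetric]) (auto intro: subset_eq_atLeast0_lessThan_card simp: lessThan_atLeast0)
  also have "\<dots> = (\<Sum>k\<in>{..n}. real (n choose k) * (1/3) ^ (k choose 2))"
    using n_subsets[of "{..<n}"] by (intro sum.cong refl) simp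
  also have "\<dots> \<le> (\<Sum>k\<in>{..n}. ?Y)"
  proof (rule sum_mono)
    fix k assume "k \<in> {..n}"
    then have "real (n choose k) \<le> real (n ^ k)"
      unfolding of_nat_le_iff by (intro binomial_le_pow) simp
    then have "real (n choose k) * (1/3) ^ (k choose 2) \<le> real n ^ k * (1/3) ^ (k choose 2)"
      by (intro mult_right_mono) auto
    also have "\<dots> = exp (real k * ln (real n) - real (k choose 2) * ln 3)"
    proof -
      have "real n ^ k = exp (real k * ln (real n))"
        using assms by (subst exp_of_nat_mult) simp
      moreover have "(3::real) ^ (k choose 2) = exp (real (k choose 2) * ln 3)"
        by (subst exp_of_nat_mult) simp
      ultimately show ?thesis unfolding exp_diff power_one_over by simp
    qed
    also have "\<dots> \<le> ?Y"
    proof -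
      have l3: "ln (3::real) > 0" by simp
      \<comment> \<open>The vertex of the parabola is at
        \<open>k = ln n / ln 3 + 1/2\<close>.\<close>
      have "0 \<le> (ln (real n) + ln 3 / 2 - real k * ln 3)\<^sup>2" by simp
      then have "(real k * ln (real n) - real (k choose 2) * ln 3) * (2 * ln 3)
          \<le> (ln (real n) + ln 3 / 2)\<^sup>2"
        by (simp add: real_choose_two power2_eq_square field_simps)
      then show ?thesis
        using l3 by (simp add: pos_le_divide_eq)
    qed
    finally show "real (n choose k) * (1/3) ^ (k choose 2) \<le> ?Y" .
  qed
  finally show ?thesis by simp
qed

lemma num_cliques_no_edges:
  assumes "finite V"
  shows "num_cliques V {} \<le> card V + 1"
proof -
  have "cliques V {} = insert {} ((\<lambda>x. {x}) ` V)"
    by (rule cliques_of_other_color[of _ UNIV]) (auto simp: clique_def)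
  then show ?thesis
    unfolding num_cliques_eq using assms card_image_le[of V "\<lambda>x. {x}"] by (simp add: card_insert_if)
qed

text \<open>Chosen so that the exponent in the final bound is exactly the logarithm of
  \<open>27 * (n + 1) ^ r * exp (3 * y)\<close> with \<open>y = (ln n + ln 3 / 2)\<^sup>2 / (2 * ln 3)\<close>.\<close>
definition upper_delta :: "nat \<Rightarrow> nat \<Rightarrow> real" where
  "upper_delta r n = (ln 27 + real r * ln (real (n + 1))
     + 3 * ((ln (real n) + ln 3 / 2)\<^sup>2 / (2 * ln 3))) * ln 3 / (3 * (ln (real n))\<^sup>2) - 1/2"

lemma upper_delta_tendsto: "upper_delta r \<longlonglongrightarrow> 0"
  unfolding upper_delta_def by real_asymp

lemma exists_small_clique_product:
  assumes r: "r \<ge> 3" and n: "n \<ge> 2"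
  shows "\<exists>c \<in> edge_colorings r n. real (clique_product r n c)
    \<le> real n powr ((3 * log 3 (real r)) * (1/2 + upper_delta r n) * log (real r) (real n))"
proof -
  obtain c where c: "c \<in> [{..<n}]\<^bsup>2\<^esup> \<rightarrow> {1..3}"
    and k: "\<And>i. i \<in> {1..3} \<Longrightarrow> real (num_cliques {..<n} (color_class n c i)) \<le> 3 * clique_weight n"
    using exists_three_coloring[of n] by blast
  let ?k = "\<lambda>i. real (num_cliques {..<n} (color_class n c i))"
  define N where "N = real (n + 1)"
  define y where "y = (ln (real n) + ln 3 / 2)\<^sup>2 / (2 * ln 3)"
  have "{1..3} \<subseteq> {1..r}" using r by auto
  then have mem: "c \<in> edge_colorings r n"
    using c unfolding edge_colorings_def by blast
  have unused: "?k i \<le> N" if "i \<in> {4..r}" for i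
  proof -
    have "color_class n c i = {}"
      using funcset_mem[OF c] that by (force simp: color_class_def)
    then show ?thesis
      using num_cliques_no_edges[of "{..<n}"] by (simp add: N_def)
  qed
  have "{1..r} = {1..3} \<union> {4..r}" using r by auto
  then have "real (clique_product r n c) = (\<Prod>i\<in>{1..3}. ?k i) * (\<Prod>i\<in>{4..r}. ?k i)"
    by (simp add: clique_product_def prod.union_disjoint)
  also have "\<dots> \<le> (\<Prod>i\<in>{1..3::nat}. 3 * (N * exp y)) * (\<Prod>i\<in>{4..r}. N)"
  proof (intro mult_mono prod_mono conjI)
    fix i :: nat assume "i \<in> {1..3}"
    then show "?k i \<le> 3 * (N * exp y)"
      using k[of i] clique_weight_le[of n] n unfolding y_def N_def by linarith
  qed (use unused N_def in \<open>auto intro!: prod_nonneg\<close>)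
  also have "\<dots> = 27 * (N ^ 3 * N ^ (r - 3)) * exp y ^ 3"
    by (simp add: power_mult_distrib mult_ac)
  also have "N ^ 3 * N ^ (r - 3) = N ^ r"
    using r by (simp flip: power_add)
  also have "27 * N ^ r * exp y ^ 3 = exp (ln 27 + real r * ln (N) + 3 * y)"
    using N_def by (simp add: exp_add exp_of_nat_mult exp_of_nat_mult[of 3, simplified])
  also have "ln 27 + real r * ln (N) + 3 * y
     = (3 * log 3 (real r)) * (1/2 + upper_delta r n) * log (real r) (real n) * ln (real n)"
  proof -
    define z where "z = ln 27 + real r * ln (N) + 3 * y"
    have pos: "ln (real n) \<noteq> 0" "ln (real r) \<noteq> 0" "ln (3::real) \<noteq> 0"
      using n r by auto
    \<comment> \<open>The logarithms telescope: \<open>log 3 r * log r n * ln n\<close> is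
      \<open>(ln n)\<^sup>2 / ln 3\<close>, the inverse of the scaling used in
      \<open>upper_delta\<close> up to the factor 3.\<close>
    have "1/2 + upper_delta r n = z * ln 3 / (3 * (ln (real n))\<^sup>2)"
      by (simp add: upper_delta_def z_def y_def N_def)
    then show ?thesis
      unfolding z_def[symmetric] log_def using pos by (simp add: power2_eq_square)
  qed
  also have "exp \<dots> = real n powr ((3 * log 3 (real r)) * (1/2 + upper_delta r n) * log (real r) (real n))"
    using n by (simp add: powr_def)
  finally show ?thesis using mem by blast
qed

theorem theorem1p10:
  fixes r :: nat
  assumes "r \<ge> 3"
  shows "(\<exists>C::real. \<exists>\<epsilon>::nat \<Rightarrow> real. C > 0 \<and> \<epsilon> \<longlonglongrightarrow> 0 \<and>
           (\<forall>n\<ge>1. \<forall>c \<in> edge_colorings r n.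
              real n powr ((1/2 + \<epsilon> n) * log (real r) (real n)) \<le> real (clique_product r n c) \<and>
              real (clique_product r n c) \<le> C * real n ^ (r choose 2) * 2 ^ n))
       \<and> (\<exists>c\<^sub>r::real. c\<^sub>r > 0 \<and>
           (\<forall>n\<ge>1. \<exists>c \<in> edge_colorings r n.
              real (clique_product r n c) \<ge> c\<^sub>r * real n ^ (r choose 2) * 2 ^ n))
       \<and> (\<exists>\<delta>::nat \<Rightarrow> real. \<delta> \<longlonglongrightarrow> 0 \<and>
           (\<forall>\<^sub>F n in sequentially. \<exists>c \<in> edge_colorings r n.
              real (clique_product r n c)
                \<le> real n powr ((3 * log 3 (real r)) * (1/2 + \<delta> n) * log (real r) (real n))))"
proof (intro conjI)
  have r: "r \<ge> 1" "r \<ge> 2" using assms by simp_all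
  obtain C :: real where "C > 0" "\<forall>n\<ge>1. \<forall>c. real (clique_product r n c) \<le> C * real n ^ (r choose 2) * 2 ^ n"
    using clique_product_upper[OF r(1)] by blast
  then show "\<exists>C::real. \<exists>\<epsilon>::nat \<Rightarrow> real. C > 0 \<and> \<epsilon> \<longlonglongrightarrow> 0 \<and>
      (\<forall>n\<ge>1. \<forall>c \<in> edge_colorings r n.
        real n powr ((1/2 + \<epsilon> n) * log (real r) (real n)) \<le> real (clique_product r n c) \<and>
        real (clique_product r n c) \<le> C * real n ^ (r choose 2) * 2 ^ n)"
    using lower_eps_tendsto[of r] clique_product_lower[OF r(2)]
    by (intro exI[of _ C] exI[of _ "lower_eps r"]) simp
  show "\<exists>c\<^sub>r::real. c\<^sub>r > 0 \<and> (\<forall>n\<ge>1. \<exists>c \<in> edge_colorings r n.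
      real (clique_product r n c) \<ge> c\<^sub>r * real n ^ (r choose 2) * 2 ^ n)"
    by (rule exists_large_clique_product[OF r(1)])
  show "\<exists>\<delta>::nat \<Rightarrow> real. \<delta> \<longlonglongrightarrow> 0 \<and> (\<forall>\<^sub>F n in sequentially. \<exists>c \<in> edge_colorings r n.
      real (clique_product r n c)
        \<le> real n powr ((3 * log 3 (real r)) * (1/2 + \<delta> n) * log (real r) (real n)))"
    using upper_delta_tendsto[of r] exists_small_clique_product[OF assms]
    by (intro exI[of _ "upper_delta r"] conjI eventually_mono[OF eventually_ge_at_top[of 2]])
qed

end
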